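(* Suppose that: (A1) $F:\mathbb{R}^n\to\mathbb{R}^m$ is continuously differentiable and there is $\kappa_{\mathrm{lg}}>0$ with $\|\nabla F^{(i)}(x)-\nabla F^{(i)}(y)\|\le \kappa_{\mathrm{lg}}\|x-y\|$ for all $x,y\in\mathbb{R}^n$, $i=1,\dots,m$, and $\nabla F^{(1)}(x),\dots,\nabla F^{(m)}(x)$ are $s$-sparse for all $x\in\mathbb{R}^n$; (A2) the set $\mathcal{L}$ is compact and there is $\kappa_{\mathrm{lf}}>0$ with $\|F(y)-F(x)\|\le\kappa_{\mathrm{lf}}\|y-x\|$ for all $x,y\in\mathcal{L}$; (A3) for every realization of the algorithm, $J_{m_k}$ is bounded for all $k$, i.e. there exists $\kappa_{\mathrm{bmj}}>0$ such that $\|J_{m_k}\|\le\kappa_{\mathrm{bmj}}$ for all $k$. Let $\beta\in(0,1)$ satisfy $\beta\ge \frac{\log\gamma_2}{\log\gamma_2-\log\gamma_1}$ and let $\kappa_{\mathrm{bv}}>0$. Let $\sigma_k=\|d_{k-1}\|$ (for $k\ge1$) and $\xi_k=\sqrt{p}\,\kappa_{\mathrm{lg}}\kappa_{\mathrm{bv}}^2\sigma_k/2$. If $\{A(V_k)\}$ is a sequence of $\beta$-probabilistically $\kappa_{\mathrm{bv}}$-bounded RIP matrices, then the random iterates $\{X_k\}$ generated by the algorithm satisfy $$\mathbb{P}\Big(\lim_{k\to\infty}\|J(X_k)^TF(X_k)\|=0\Big)=1.$$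
   Context: Norms: $\|\cdot\|$ is the Euclidean norm of vectors and the spectral norm of matrices, $\|\cdot\|_1$ is the $\ell_1$ norm. $F=(F^{(1)},\dots,F^{(m)}):\mathbb{R}^n\to\mathbb{R}^m$ is continuously differentiable with Jacobian $J(x)\in\mathbb{R}^{m\times n}$; the problem is to minimize $\frac12\|F(x)\|^2$. A vector is $s$-sparse if it has at most $s$ nonzero entries ($s\geq 1$ a fixed integer). $p<n$ is a fixed positive integer. Algorithm. Parameters: $0<\eta_0<1$, $0<\eta_1<\eta_2$, $0<\gamma_1<1<\gamma_2$, $x_0\in\mathbb{R}^n$, $\theta_0\ge\theta_{\min}>0$. For $k=0,1,2,\dots$: (1) Generate random vectors $v_k=\{v_k^1,\dots,v_k^p\}\subset\mathbb{R}^n$. Let $A(v_k)\in\mathbb{R}^{p\times n}$ be the matrix with rows $(v_k^1)^T,\dots,(v_k^p)^T$ and, for $i=1,\dots,m$, let $y_k^{(i)}\in\mathbb{R}^p$ have entries $F^{(i)}(x_k+\sigma_kv_k^j)-F^{(i)}(x_k)$, $j=1,\dots,p$. With $\sigma_k>0$, $\xi_k>0$, let $g_k^{(i)}$ be a solution of $\min_{g\in\mathbb{R}^n}\|g\|_1$ subject to $\|A(v_k)g-\sigma_k^{-1}y_k^{(i)}\|\le\xi_k$, and let $J_{m_k}\in\mathbb{R}^{m\times n}$ be the matrix with rows $(g_k^{(1)})^T,\dots,(g_k^{(m)})^T$. (2) With $F_k=F(x_k)$, let $d_k$ solve $(J_{m_k}^TJ_{m_k}+\lambda_kI)d=-J_{m_k}^TF_k$,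 where $\lambda_k=\theta_k\|J_{m_k}^TF_k\|$. (3) Let $\rho_k=\dfrac{\|F_k\|^2-\|F(x_k+d_k)\|^2}{\|F_k\|^2-\|F_k+J_{m_k}d_k\|^2}$. (4) Set $x_{k+1}=x_k+d_k$ if $\rho_k\ge\eta_0$, and $x_{k+1}=x_k$ otherwise. (5) If $\rho_k<\eta_0$ set $\theta_{k+1}=\gamma_2\theta_k$. Otherwise set $\theta_{k+1}=\gamma_2\theta_k$ if $\|J_{m_k}^TF_k\|<\eta_1/\theta_k$; $\theta_{k+1}=\theta_k$ if $\|J_{m_k}^TF_k\|\in[\eta_1/\theta_k,\eta_2/\theta_k]$; $\theta_{k+1}=\max\{\gamma_1\theta_k,\theta_{\min}\}$ if $\|J_{m_k}^TF_k\|>\eta_2/\theta_k$. The initial $\sigma_0>0$ is arbitrary. The algorithm is assumed to be well defined and to run for infinitely many iterations: the $\ell_1$ problems are solvable and $J_{m_k}^TF_k\neq0$ for all $k$. The random quantities have capital letters, their realizations lower-case letters: $V_k$ is the random collection with realization $v_k$, and $X_k,\Theta_k$ are the random iterate and parameter with realizations $x_k,\theta_k$. The only source of randomness is $V_0,V_1,\dots$, so $X_k$ and $\Theta_k$ are (measurably) determined by $V_0,\dots,V_{k-1}$. Level sets: $\mathcal{L}_0=\{x\in\mathbb{R}^n:\|F(x)\|\le\|F(x_0)\|\}$ and $\mathcal{L}=\mathcal{L}_0\cup\bigcup_{x\in\mathcal{L}_0}B(x,\theta_{\min}^{-1})$, where $B(x,r)$ is the closed ball of radius $r$ about $x$. RIP: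 the $q$-RIP constant $\delta_q$ of a matrix $A$ is the smallest number such that $(1-\delta_q)\|x\|^2\le\|Ax\|^2\le(1+\delta_q)\|x\|^2$ for all $q$-sparse $x$. $A$ is called an RIP matrix if its $2s$-RIP constant satisfies $\delta_{2s}<0.4931$. Let $T_k$ be the event that $A(V_k)$ is an RIP matrix and $\|V_k^j\|\le\kappa_{\mathrm{bv}}$ for all $j=1,\dots,p$. For $\beta\in(0,1)$ and $\kappa_{\mathrm{bv}}>0$, $\{A(V_k)\}$ is a sequence of $\beta$-probabilistically $\kappa_{\mathrm{bv}}$-bounded RIP matrices if $\mathbb{P}(T_k\mid\mathcal{F}_{k-1})\ge\beta$ for all $k$, where $\mathcal{F}_{k-1}$ is the $\sigma$-algebra generated by $V_0,\dots,V_{k-1}$. *)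

theory Defs
  imports "HOL-Probability.Probability"
begin

section \<open>Sparsity and restricted isometries\<close>

definition sparse_vec :: "nat \<Rightarrow> real^'n \<Rightarrow> bool" where
  "sparse_vec q x \<longleftrightarrow> card {i. x $ i \<noteq> 0} \<le> q"

definition l1_norm :: "real^'n \<Rightarrow> real" where
  "l1_norm x = (\<Sum>i\<in>UNIV. \<bar>x $ i\<bar>)"

definition spectral_norm :: "real^'n^'m \<Rightarrow> real" where
  "spectral_norm A = onorm ((*v) A)"

definition rip_bound :: "nat \<Rightarrow> real^'n^'p \<Rightarrow> real \<Rightarrow> bool" where
  "rip_bound q A \<delta> \<longleftrightarrow> (\<forall>x. sparse_vec q x \<longrightarrow>
     (1 - \<delta>) * (norm x)\<^sup>2 \<le> (norm (A *v x))\<^sup>2 \<and> (norm (A *v x))\<^sup>2 \<le> (1 + \<delta>) * (norm x)\<^sup>2)"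

definition rip_constant :: "nat \<Rightarrow> real^'n^'p \<Rightarrow> real" where
  "rip_constant q A = (LEAST \<delta>. rip_bound q A \<delta>)"

definition RIP_matrix :: "nat \<Rightarrow> real^'n^'p \<Rightarrow> bool" where
  "RIP_matrix s A \<longleftrightarrow> rip_constant (2 * s) A < 0.4931"

text \<open>The minimum in \<^const>\<open>rip_constant\<close> exists as soon as a nonzero \<open>q\<close>-sparse vector does.\<close>

lemma rip_constant_least:
  fixes A :: "real^'n^'p"
  assumes "q \<ge> 1"
  shows "rip_bound q A (rip_constant q A)"
    and "rip_bound q A \<delta> \<Longrightarrow> rip_constant q A \<le> \<delta>"
proof -
  let ?S = "{\<delta>. rip_bound q A \<delta>}"
  obtain i :: 'n where True by blast
  have sp: "sparse_vec q (axis i 1 :: real^'n)"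
  proof -
    have "{j. (axis i 1 :: real^'n) $ j \<noteq> 0} = {i}" by (auto simp: axis_def)
    with assms show ?thesis by (simp add: sparse_vec_def)
  qed
  have lower: "0 \<le> \<delta>" if "rip_bound q A \<delta>" for \<delta>
  proof -
    from that sp have "1 - \<delta> \<le> 1 + \<delta>"
      unfolding rip_bound_def by (smt (verit) norm_axis_1 mult_cancel_left2 power_one mult.right_neutral)
    then show ?thesis by simp
  qed
  obtain B where B: "B > 0" "\<And>x. norm (A *v x) \<le> norm x * B"
    using bounded_linear.pos_bounded[OF matrix_vector_mul_bounded_linear[of A]] by blast
  have "rip_bound q A (max 1 (B\<^sup>2))"
    unfolding rip_bound_def
  proof (intro allI impI conjI)
    fix x :: "real^'n"
    have "(1 - max 1 (B\<^sup>2)) * (norm x)\<^sup>2 \<le> 0"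
      by (intro mult_nonpos_nonneg) auto
    also have "\<dots> \<le> (norm (A *v x))\<^sup>2" by simp
    finally show "(1 - max 1 (B\<^sup>2)) * (norm x)\<^sup>2 \<le> (norm (A *v x))\<^sup>2" .
    have "(norm (A *v x))\<^sup>2 \<le> (norm x * B)\<^sup>2" using B(2) by (intro power_mono) auto
    also have "\<dots> = B\<^sup>2 * (norm x)\<^sup>2" by (simp add: power_mult_distrib)
    also have "\<dots> \<le> (1 + max 1 (B\<^sup>2)) * (norm x)\<^sup>2" by (intro mult_right_mono) auto
    finally show "(norm (A *v x))\<^sup>2 \<le> (1 + max 1 (B\<^sup>2)) * (norm x)\<^sup>2" .
  qed
  then have ne: "?S \<noteq> {}" by blast
  have bdd: "bdd_below ?S" using lower by (auto intro!: bdd_belowI[of _ 0])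
  have "?S = (\<Inter>x\<in>{x. sparse_vec q x}.
      {\<delta>. (1 - \<delta>) * (norm x)\<^sup>2 \<le> (norm (A *v x))\<^sup>2} \<inter> {\<delta>. (norm (A *v x))\<^sup>2 \<le> (1 + \<delta>) * (norm x)\<^sup>2})"
    by (auto simp: rip_bound_def)
  also have "closed \<dots>"
    by (intro closed_INT ballI closed_Int closed_Collect_le continuous_intros)
  finally have "Inf ?S \<in> ?S" using closed_contains_Inf[OF ne bdd] by blast
  moreover have "Inf ?S \<le> \<delta>" if "rip_bound q A \<delta>" for \<delta>
    using that bdd by (auto intro: cInf_lower)
  ultimately have *: "rip_bound q A (Inf ?S)" "\<And>\<delta>. rip_bound q A \<delta> \<Longrightarrow> Inf ?S \<le> \<delta>" by auto
  then have "rip_constant q A = Inf ?S"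
    unfolding rip_constant_def by (intro Least_equality) auto
  with * show "rip_bound q A (rip_constant q A)"
    and "rip_bound q A \<delta> \<Longrightarrow> rip_constant q A \<le> \<delta>" by auto
qed

section \<open>Realizations of the algorithm\<close>

definition C1_map :: "(real^'n \<Rightarrow> real^'m) \<Rightarrow> bool" where
  "C1_map F \<longleftrightarrow> (\<forall>x. F differentiable (at x)) \<and> continuous_on UNIV (\<lambda>x. jacobian F (at x))"

definition diff_vec ::
    "(real^'n \<Rightarrow> real^'m) \<Rightarrow> real^'n \<Rightarrow> real \<Rightarrow> real^'n^'p \<Rightarrow> 'm \<Rightarrow> real^'p" where
  "diff_vec F x \<sigma> v i = (\<chi> j. F (x + \<sigma> *\<^sub>R (v $ j)) $ i - F x $ i)"

definition l1_solution :: "real^'n^'p \<Rightarrow> real^'p \<Rightarrow> real \<Rightarrow> real^'n \<Rightarrow> bool" where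
  "l1_solution A b \<xi> g \<longleftrightarrow> norm (A *v g - b) \<le> \<xi> \<and>
     (\<forall>h. norm (A *v h - b) \<le> \<xi> \<longrightarrow> l1_norm g \<le> l1_norm h)"

definition reduction_ratio ::
    "(real^'n \<Rightarrow> real^'m) \<Rightarrow> real^'n \<Rightarrow> real^'n^'m \<Rightarrow> real^'n \<Rightarrow> real" where
  "reduction_ratio F x J d =
     ((norm (F x))\<^sup>2 - (norm (F (x + d)))\<^sup>2) / ((norm (F x))\<^sup>2 - (norm (F x + J *v d))\<^sup>2)"

text \<open>
  \<open>\<rho>\<close> is the reduction ratio and \<open>G\<close> the norm of the model gradient.
\<close>

definition theta_update ::
    "real \<Rightarrow> real \<Rightarrow> real \<Rightarrow> real \<Rightarrow> real \<Rightarrow> real \<Rightarrow> real \<Rightarrow> real \<Rightarrow> real \<Rightarrow> real" where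
  "theta_update \<eta>0 \<eta>1 \<eta>2 \<gamma>1 \<gamma>2 \<theta>min \<rho> G \<theta> =
     (if \<rho> < \<eta>0 then \<gamma>2 * \<theta>
      else if G < \<eta>1 / \<theta> then \<gamma>2 * \<theta>
      else if G \<le> \<eta>2 / \<theta> then \<theta>
      else max (\<gamma>1 * \<theta>) \<theta>min)"

text \<open>
  One infinite realization of the algorithm, driven by the sampled collections \<open>v k\<close>.
  The collection of \<open>p\<close> vectors \<open>v k $ j\<close> is stored as the matrix having them as rows, so that
  \<open>v k\<close> is itself the measurement matrix \<open>A(v k)\<close>; row \<open>i\<close> of the model Jacobian \<open>J k\<close> is
  the gradient model of the \<open>i\<close>-th component. The realization is a relation rather than
  a function because the \<open>l1\<close> minimizers need not be unique. The requirements that minimizers exist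
  and that the model gradient never vanishes express that the algorithm is well defined
  and does not stop.
\<close>

definition lm_realization ::
    "(real^'n \<Rightarrow> real^'m) \<Rightarrow> real \<Rightarrow> real \<Rightarrow> real \<Rightarrow> real \<Rightarrow> real \<Rightarrow> real \<Rightarrow> real^'n \<Rightarrow> real \<Rightarrow>
     (nat \<Rightarrow> real) \<Rightarrow> (nat \<Rightarrow> real) \<Rightarrow> (nat \<Rightarrow> real^'n^'p) \<Rightarrow>
     (nat \<Rightarrow> real^'n) \<Rightarrow> (nat \<Rightarrow> real) \<Rightarrow> (nat \<Rightarrow> real^'n^'m) \<Rightarrow> (nat \<Rightarrow> real^'n) \<Rightarrow> bool" where
  "lm_realization F \<eta>0 \<eta>1 \<eta>2 \<gamma>1 \<gamma>2 \<theta>min x0 \<theta>0 \<sigma> \<xi> v x \<theta> J d \<longleftrightarrow>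
     x 0 = x0 \<and> \<theta> 0 = \<theta>0 \<and>
     (\<forall>k. let g = transpose (J k) *v F (x k);
              \<rho> = reduction_ratio F (x k) (J k) (d k)
          in \<sigma> k > 0 \<and> \<xi> k > 0 \<and>
             (\<forall>i. l1_solution (v k) ((1 / \<sigma> k) *\<^sub>R diff_vec F (x k) (\<sigma> k) (v k) i) (\<xi> k) (J k $ i)) \<and>
             g \<noteq> 0 \<and>
             (transpose (J k) ** J k + (\<theta> k * norm g) *\<^sub>R mat 1) *v d k = - g \<and>
             x (Suc k) = (if \<rho> \<ge> \<eta>0 then x k + d k else x k) \<and>
             \<theta> (Suc k) = theta_update \<eta>0 \<eta>1 \<eta>2 \<gamma>1 \<gamma>2 \<theta>min \<rho> (norm g) (\<theta> k))"

definition level_set :: "(real^'n \<Rightarrow> real^'m) \<Rightarrow> real^'n \<Rightarrow> (real^'n) set" where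
  "level_set F x0 = {x. norm (F x) \<le> norm (F x0)}"

definition enlarged_level_set :: "(real^'n \<Rightarrow> real^'m) \<Rightarrow> real^'n \<Rightarrow> real \<Rightarrow> (real^'n) set" where
  "enlarged_level_set F x0 \<theta>min =
     level_set F x0 \<union> (\<Union>x\<in>level_set F x0. cball x (inverse \<theta>min))"

section \<open>The sampling process\<close>

text \<open>
  The \<open>\<sigma>\<close>-algebra generated by \<open>V 0, \<dots>, V (k - 1)\<close>; it is trivial for \<open>k = 0\<close>.
\<close>

definition past :: "'w measure \<Rightarrow> (nat \<Rightarrow> 'w \<Rightarrow> 'v::topological_space) \<Rightarrow> nat \<Rightarrow> 'w measure" where
  "past M V k = sigma (space M) (\<Union>j<k. {V j -` B \<inter> space M | B. B \<in> sets borel})"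

definition bounded_RIP_event ::
    "'w measure \<Rightarrow> nat \<Rightarrow> real \<Rightarrow> ('w \<Rightarrow> real^'n^'p) \<Rightarrow> 'w set" where
  "bounded_RIP_event M s \<kappa> A =
     {\<omega> \<in> space M. RIP_matrix s (A \<omega>) \<and> (\<forall>j. norm (A \<omega> $ j) \<le> \<kappa>)}"

definition prob_bounded_RIP ::
    "'w measure \<Rightarrow> nat \<Rightarrow> real \<Rightarrow> real \<Rightarrow> (nat \<Rightarrow> 'w \<Rightarrow> real^'n^'p) \<Rightarrow> bool" where
  "prob_bounded_RIP M s \<beta> \<kappa> V \<longleftrightarrow>
     (\<forall>k. AE \<omega> in M.
        real_cond_exp M (past M V k) (indicator (bounded_RIP_event M s \<kappa> (V k))) \<omega> \<ge> \<beta>)"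

end

theory Submission
  imports Defs
begin

text \<open>
  The iterates are analysed as a random walk of the regularization parameter.

  On a good iteration, when the sampling matrix is a bounded RIP matrix, each row of the model
  Jacobian is close to the gradient of the corresponding component. The gradient is sparse and,
  by Taylor's formula, feasible for the \<open>l1\<close> problem, and the \<open>l1\<close> minimizer differs from any
  sparse feasible vector by at most a multiple of the tolerance
  (\<open>l1_recovery\<close>, \<open>l1_model_error\<close>). The tolerance is proportional to the previous step
  length, hence to \<open>1 / \<theta>\<close>, so the model gets better as \<open>\<theta>\<close> grows.

  The parameter \<open>\<theta>\<close> always tends to infinity: it fails to grow by the factor \<open>\<gamma>2\<close> only on
  successful steps with \<open>\<theta> G \<ge> \<eta>1\<close>, \<open>G\<close> being the norm of the model gradient. These decrease
  \<open>\<parallel>F\<parallel>\<^sup>2\<close> by at least a multiple of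
  \<open>G / \<theta>\<close>, and hence of \<open>1 / \<theta>\<^sup>2\<close>, so \<open>1 / \<theta>\<^sup>2\<close> is summable
  (\<open>summable_inverse_\<theta>_square\<close>). For large \<open>\<theta>\<close>, a good iteration at
  which the gradient is at least \<open>\<epsilon>\<close> is therefore successful, multiplies \<open>\<theta>\<close> by
  \<open>\<gamma>1\<close> and decreases \<open>\<parallel>F\<parallel>\<^sup>2\<close> by at least a multiple of \<open>1 / \<theta>\<close> (\<open>good_step\<close>).

  Two probabilistic facts then suffice. First, the walk that goes up by \<open>- ln \<gamma>1\<close> on good
  iterations and down by \<open>ln \<gamma>2\<close> on the others has nonnegative conditional drift, which is what the
  lower bound on \<open>\<beta>\<close> says, and so it is almost surely unbounded above (\<open>walk_unbounded\<close>). If the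
  gradient stayed above some \<open>\<epsilon>\<close>, then \<open>ln \<theta>\<close> would stay below a constant minus this walk,
  contradicting \<open>\<theta> \<ge> \<theta>min\<close>; so the gradients have lower limit zero. Secondly, the sum of \<open>1 / \<theta>\<close> over
  the good iterations with gradient at least \<open>\<epsilon>\<close> is finite, since each such term is paid for by a
  decrease of \<open>\<parallel>F\<parallel>\<^sup>2\<close>, and a conditional Borel--Cantelli argument
  (\<open>summable_of_summable_on_T\<close>) extends this to all iterations with gradient at least \<open>\<epsilon>\<close>.
  As steps are no longer than \<open>1 / \<theta>\<close> and the gradient is Lipschitz on the level set, the gradient
  cannot climb from below \<open>\<epsilon>\<close> to above \<open>3 \<epsilon>\<close> infinitely often, and so it
  converges to zero (\<open>tendsto_zero_of_summable_excursions\<close>, \<open>gradient_tendsto_zero\<close>).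
\<close>

section \<open>Stable recovery of sparse vectors by \<open>l1\<close> minimization\<close>

lemma exists_top_subset:
  fixes f :: "'a \<Rightarrow> real"
  assumes "finite T"
  shows "\<exists>U\<subseteq>T. card U \<le> s \<and> (U = T \<or> card U = s) \<and> (\<forall>i\<in>U. \<forall>j\<in>T - U. f j \<le> f i)"
proof (induction s)
  case 0
  then show ?case by (intro exI[of _ "{}"]) auto
next
  case (Suc s)
  then obtain U where U: "U \<subseteq> T" "card U \<le> s" "U = T \<or> card U = s" "\<forall>i\<in>U. \<forall>j\<in>T - U. f j \<le> f i"
    by blast
  show ?case
  proof (cases "U = T")
    case True
    then show ?thesis using U by (intro exI[of _ T]) auto
  next
    case False
    define m where "m = Max (f ` (T - U))"
    have fin: "finite (f ` (T - U))" "f ` (T - U) \<noteq> {}" using False U assms by auto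
    have "m \<in> f ` (T - U)" using Max_in[OF fin] by (simp add: m_def)
    then obtain a where a: "a \<in> T - U" "f a = m" by blast
    have "f j \<le> f a" if "j \<in> T - U" for j using that fin a m_def by auto
    moreover have "card (insert a U) = Suc s"
      using a U False assms by (auto simp: finite_subset)
    ultimately show ?thesis using U a by (intro exI[of _ "insert a U"]) auto
  qed
qed

text \<open>
  A linear functional with nonnegative coefficients, maximized over weights in \<open>{0..a}\<close> of total at
  most \<open>s * a\<close>, is largest when the weight \<open>a\<close> sits on the \<open>s\<close> largest coefficients. The proof
  subtracts the largest remaining coefficient \<open>m\<close> from every coefficient: above the threshold \<open>m\<close>
  the weights are at most \<open>a\<close>, and the part up to \<open>m\<close> is controlled by the total.
\<close>
lemma weighted_sum_le_top_sum:
  fixes c w :: "'a \<Rightarrow> real"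
  assumes fin: "finite T" and UT: "U \<subseteq> T" and card: "U = T \<or> card U = s"
    and top: "\<forall>i\<in>U. \<forall>j\<in>T - U. c j \<le> c i"
    and c: "\<And>i. i \<in> T \<Longrightarrow> 0 \<le> c i"
    and w: "\<And>i. i \<in> T \<Longrightarrow> 0 \<le> w i" "\<And>i. i \<in> T \<Longrightarrow> w i \<le> a"
    and total: "(\<Sum>i\<in>T. w i) \<le> real s * a"
  shows "(\<Sum>i\<in>T. c i * w i) \<le> (\<Sum>i\<in>U. c i * a)"
proof (cases "U = T")
  case True
  then show ?thesis using c w by (auto intro!: sum_mono mult_left_mono)
next
  case False
  define m where "m = Max (c ` (T - U))"
  have fin': "finite (c ` (T - U))" "c ` (T - U) \<noteq> {}" using False UT fin by auto
  have m1: "c i \<le> m" if "i \<in> T - U" for i using that fin' m_def by auto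
  have m2: "m \<le> c i" if "i \<in> U" for i using that fin' top unfolding m_def by auto
  have m0: "0 \<le> m"
  proof -
    from False UT obtain j where "j \<in> T - U" by blast
    with m1[of j] c[of j] show ?thesis by auto
  qed
  have "(\<Sum>i\<in>T. c i * w i) \<le> (\<Sum>i\<in>T. (if i \<in> U then (c i - m) * a else 0) + m * w i)"
  proof (rule sum_mono)
    fix i assume i: "i \<in> T"
    show "c i * w i \<le> (if i \<in> U then (c i - m) * a else 0) + m * w i"
    proof (cases "i \<in> U")
      case True
      have "(c i - m) * w i \<le> (c i - m) * a" using m2[OF True] w i by (intro mult_left_mono) auto
      then show ?thesis using True by (simp add: algebra_simps)
    next
      case False
      then show ?thesis using m1[of i] w i by (auto intro!: mult_right_mono)
    qed
  qed
  also have "\<dots> = (\<Sum>i\<in>U. (c i - m) * a) + m * (\<Sum>i\<in>T. w i)"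
    using UT fin by (simp add: sum.distrib sum_distrib_left sum.If_cases Int_absorb1 Int_commute)
  also have "\<dots> \<le> (\<Sum>i\<in>U. (c i - m) * a) + m * (real s * a)"
    using total m0 by (intro add_left_mono mult_left_mono) auto
  also have "\<dots> = (\<Sum>i\<in>U. c i * a)"
    using card False by (simp add: left_diff_distrib sum_subtractf)
  finally show ?thesis .
qed

definition restrict_vec :: "'n set \<Rightarrow> real^'n \<Rightarrow> real^'n" where
  "restrict_vec S x = (\<chi> i. if i \<in> S then x $ i else 0)"

lemma restrict_vec_add_Compl: "restrict_vec S x + restrict_vec (- S) x = x"
  by (simp add: restrict_vec_def vec_eq_iff)

lemma power2_norm_vec: "(norm (x :: real^'n))\<^sup>2 = (\<Sum>i\<in>UNIV. (x $ i)\<^sup>2)"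
  by (simp add: norm_vec_def L2_set_def sum_nonneg)

lemma power2_norm_restrict_vec: "(norm (restrict_vec S x))\<^sup>2 = (\<Sum>i\<in>S. (x $ i)\<^sup>2)"
proof -
  have "(norm (restrict_vec S x))\<^sup>2 = (\<Sum>i\<in>UNIV. if i \<in> S then (x $ i)\<^sup>2 else 0)"
    unfolding power2_norm_vec restrict_vec_def by (intro sum.cong) auto
  then show ?thesis by (simp add: sum.If_cases)
qed

text \<open>
  Restricted isometries almost preserve orthogonality: for vectors with disjoint supports
  the polarization identity compares \<open>A (u + w)\<close> with \<open>A (u - w)\<close>, whose arguments have equal norms.
\<close>
lemma RIP_disjoint_inner_ge:
  fixes A :: "real^'n^'p"
  assumes rip: "rip_bound (2 * s) A \<delta>" and \<delta>: "0 \<le> \<delta>"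
    and S: "card S \<le> s" and U: "card U \<le> s" and disj: "S \<inter> U = {}"
    and u: "\<And>i. i \<notin> S \<Longrightarrow> u $ i = 0" and w: "\<And>i. i \<notin> U \<Longrightarrow> w $ i = 0"
    and r: "(norm u)\<^sup>2 \<le> r" "(norm w)\<^sup>2 \<le> r"
  shows "(A *v u) \<bullet> (A *v w) \<ge> - \<delta> * r"
proof -
  have sp: "sparse_vec (2 * s) z" if "\<And>i. i \<notin> S \<union> U \<Longrightarrow> z $ i = 0" for z :: "real^'n"
  proof -
    have "{i. z $ i \<noteq> 0} \<subseteq> S \<union> U" using that by auto
    then have "card {i. z $ i \<noteq> 0} \<le> card (S \<union> U)" by (intro card_mono) auto
    also have "\<dots> \<le> 2 * s" using card_Un_le[of S U] S U by linarith
    finally show ?thesis by (simp add: sparse_vec_def)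
  qed
  have orth: "u \<bullet> w = 0"
    unfolding inner_vec_def
  proof (intro sum.neutral ballI)
    fix i
    have "u $ i = 0 \<or> w $ i = 0" using u[of i] w[of i] disj by blast
    then show "u $ i \<bullet> w $ i = 0" by auto
  qed
  have n1: "(norm (u + w))\<^sup>2 = (norm u)\<^sup>2 + (norm w)\<^sup>2"
    and n2: "(norm (u - w))\<^sup>2 = (norm u)\<^sup>2 + (norm w)\<^sup>2"
    using orth by (simp_all add: power2_norm_eq_inner inner_simps inner_commute)
  have "(1 - \<delta>) * (norm (u + w))\<^sup>2 \<le> (norm (A *v (u + w)))\<^sup>2"
    using rip sp[of "u + w"] u w unfolding rip_bound_def by auto
  moreover have "(norm (A *v (u - w)))\<^sup>2 \<le> (1 + \<delta>) * (norm (u - w))\<^sup>2"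
    using rip sp[of "u - w"] u w unfolding rip_bound_def by auto
  moreover have "(norm (A *v (u + w)))\<^sup>2 - (norm (A *v (u - w)))\<^sup>2 = 4 * ((A *v u) \<bullet> (A *v w))"
    by (simp add: power2_norm_eq_inner matrix_vector_right_distrib
        matrix_vector_mult_diff_distrib inner_simps inner_commute)
  ultimately have "4 * ((A *v u) \<bullet> (A *v w)) \<ge> - 2 * \<delta> * ((norm u)\<^sup>2 + (norm w)\<^sup>2)"
    unfolding n1 n2 by (simp add: algebra_simps)
  moreover have "\<delta> * ((norm u)\<^sup>2 + (norm w)\<^sup>2) \<le> \<delta> * (2 * r)"
    using r \<delta> by (intro mult_left_mono) auto
  ultimately show ?thesis by (simp add: algebra_simps)
qed

text \<open>
  The threshold \<open>1 / 2\<close> comes from the following argument. Let \<open>h = g - z\<close>, let \<open>h0\<close> be the part of \<open>h\<close> on its \<open>s\<close> largest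
  entries, and let \<open>\<alpha>\<close> be the \<open>l1\<close> norm of \<open>h0\<close> divided by \<open>s\<close>. Minimality of \<open>g\<close> and sparsity of \<open>z\<close> put the remainder
  \<open>h1\<close> into the polytope of vectors with entries at most \<open>\<alpha>\<close> and \<open>l1\<close> norm at most \<open>s * \<alpha>\<close>. The linear
  functional \<open>w \<mapsto> (A h0) \<bullet> (A w)\<close> is bounded below on that polytope by its value at an
  \<open>s\<close>-sparse vector \<open>w\<close> with \<open>norm w \<le> norm h0\<close> and support disjoint from that of \<open>h0\<close>. Hence
  \<open>(A h0) \<bullet> (A h1) \<ge> - \<delta> * (norm h0)\<^sup>2\<close>, so that \<open>(A h0) \<bullet> (A h) \<ge> (1 - 2 * \<delta>) * (norm h0)\<^sup>2\<close>, while \<open>A h\<close> has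
  norm at most \<open>2 * \<xi>\<close>.
\<close>
lemma l1_recovery:
  fixes A :: "real^'n^'p"
  assumes rip: "rip_bound (2 * s) A \<delta>" and \<delta>: "0 \<le> \<delta>" "\<delta> < 1 / 2" and s: "1 \<le> s"
    and sparse: "sparse_vec s z" and feas: "norm (A *v z - b) \<le> \<xi>"
    and sol: "l1_solution A b \<xi> g"
  shows "norm (g - z) \<le> 4 * sqrt (1 + \<delta>) / (1 - 2 * \<delta>) * \<xi>"
proof -
  define h where "h = g - z"
  define S where "S = {i. z $ i \<noteq> 0}"
  have cS: "card S \<le> s" using sparse by (simp add: S_def sparse_vec_def)
  have split: "(\<Sum>i\<in>UNIV. f i) = (\<Sum>i\<in>R. f i) + (\<Sum>i\<in>-R. f i)" for f :: "'n \<Rightarrow> real" and R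
    by (metis Compl_eq_Diff_UNIV finite_class.finite_UNIV subset_UNIV sum.subset_diff add.commute)
  have cone: "(\<Sum>i\<in>-S. \<bar>h $ i\<bar>) \<le> (\<Sum>i\<in>S. \<bar>h $ i\<bar>)"
  proof -
    have "l1_norm g \<le> l1_norm z" using sol feas by (auto simp: l1_solution_def)
    moreover have "l1_norm g = (\<Sum>i\<in>S. \<bar>g $ i\<bar>) + (\<Sum>i\<in>-S. \<bar>h $ i\<bar>)"
      unfolding l1_norm_def split[of _ S] by (auto simp: S_def h_def intro!: sum.cong)
    moreover have "l1_norm z = (\<Sum>i\<in>S. \<bar>z $ i\<bar>)"
      unfolding l1_norm_def split[of _ S] by (auto simp: S_def intro!: sum.neutral)
    moreover have "(\<Sum>i\<in>S. \<bar>z $ i\<bar>) \<le> (\<Sum>i\<in>S. \<bar>g $ i\<bar> + \<bar>h $ i\<bar>)"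
      by (intro sum_mono) (auto simp: h_def)
    ultimately show ?thesis by (simp add: sum.distrib)
  qed
  \<comment> \<open>\<open>T\<close> holds the \<open>s\<close> largest entries of \<open>h\<close>, or all of them if there are fewer than \<open>s\<close>.\<close>
  obtain T where T: "card T \<le> s" "T = UNIV \<or> card T = s"
      "\<forall>i\<in>T. \<forall>j\<in>UNIV - T. \<bar>h $ j\<bar> \<le> \<bar>h $ i\<bar>"
    using exists_top_subset[of "UNIV :: 'n set" s "\<lambda>i. \<bar>h $ i\<bar>"] by auto
  have ST: "(\<Sum>i\<in>S. \<bar>h $ i\<bar>) \<le> (\<Sum>i\<in>T. \<bar>h $ i\<bar>)"
  proof -
    have "(\<Sum>i\<in>UNIV. \<bar>h $ i\<bar> * (if i \<in> S then 1 else 0)) \<le> (\<Sum>i\<in>T. \<bar>h $ i\<bar> * 1)"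
      by (rule weighted_sum_le_top_sum[where s = s]) (use T cS in \<open>auto simp: sum.If_cases\<close>)
    then show ?thesis by (simp add: if_distrib sum.If_cases cong: if_cong)
  qed
  have cone': "(\<Sum>i\<in>-T. \<bar>h $ i\<bar>) \<le> (\<Sum>i\<in>T. \<bar>h $ i\<bar>)"
    using cone ST split[of "\<lambda>i. \<bar>h $ i\<bar>" S] split[of "\<lambda>i. \<bar>h $ i\<bar>" T] by linarith
  define \<alpha> where "\<alpha> = (\<Sum>i\<in>T. \<bar>h $ i\<bar>) / s"
  have \<alpha>0: "0 \<le> \<alpha>" by (simp add: \<alpha>_def sum_nonneg)
  have s\<alpha>: "real s * \<alpha> = (\<Sum>i\<in>T. \<bar>h $ i\<bar>)" using s by (simp add: \<alpha>_def)
  have tail_le: "\<bar>h $ j\<bar> \<le> \<alpha>" if "j \<in> - T" for j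
  proof -
    have "T \<noteq> UNIV" using that by auto
    then have "card T = s" using T by auto
    then have "real s * \<bar>h $ j\<bar> = (\<Sum>i\<in>T. \<bar>h $ j\<bar>)" by simp
    also have "\<dots> \<le> real s * \<alpha>" unfolding s\<alpha> using T that by (intro sum_mono) auto
    finally show ?thesis using s by simp
  qed
  define h0 where "h0 = restrict_vec T h"
  define h1 where "h1 = restrict_vec (- T) h"
  have hsum: "h = h0 + h1" by (simp add: h0_def h1_def restrict_vec_add_Compl)
  have \<alpha>2: "real s * \<alpha>\<^sup>2 \<le> (norm h0)\<^sup>2"
  proof -
    have "(real s * \<alpha>)\<^sup>2 \<le> (\<Sum>i\<in>T. \<bar>h $ i\<bar>\<^sup>2) * (\<Sum>i\<in>T. 1\<^sup>2)"
      unfolding s\<alpha> using Cauchy_Schwarz_ineq_sum[of "\<lambda>i. \<bar>h $ i\<bar>" "\<lambda>_. 1" T] by simp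
    also have "\<dots> = (norm h0)\<^sup>2 * card T" by (simp add: h0_def power2_norm_restrict_vec)
    also have "\<dots> \<le> (norm h0)\<^sup>2 * s" using T by (intro mult_left_mono) auto
    finally have "real s * (real s * \<alpha>\<^sup>2) \<le> real s * (norm h0)\<^sup>2"
      by (simp add: power2_eq_square algebra_simps)
    then show ?thesis using s by simp
  qed
  have h1_le: "(norm h1)\<^sup>2 \<le> (norm h0)\<^sup>2"
  proof -
    have "(norm h1)\<^sup>2 = (\<Sum>i\<in>-T. \<bar>h $ i\<bar> * \<bar>h $ i\<bar>)"
      unfolding h1_def power2_norm_restrict_vec by (simp add: power2_eq_square)
    also have "\<dots> \<le> (\<Sum>i\<in>-T. \<alpha> * \<bar>h $ i\<bar>)"
      using tail_le by (intro sum_mono mult_right_mono) auto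
    also have "\<dots> \<le> \<alpha> * (real s * \<alpha>)"
      unfolding sum_distrib_left[symmetric] s\<alpha> using cone' \<alpha>0 by (intro mult_left_mono)
    also have "\<dots> \<le> (norm h0)\<^sup>2" using \<alpha>2 by (simp add: power2_eq_square algebra_simps)
    finally show ?thesis .
  qed
  \<comment> \<open>The coefficients of the linear functional \<open>w \<mapsto> (A h0) \<bullet> (A w)\<close>.\<close>
  define c where "c = transpose A *v (A *v h0)"
  have cw: "(A *v h0) \<bullet> (A *v w) = (\<Sum>i\<in>UNIV. c $ i * w $ i)" for w
  proof -
    have "(A *v h0) \<bullet> (A *v w) = c \<bullet> w"
      by (simp add: c_def dot_lmul_matrix transpose_matrix_vector)
    then show ?thesis by (simp add: inner_vec_def)
  qed
  obtain U where U: "U \<subseteq> - T" "card U \<le> s" "U = - T \<or> card U = s"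
      "\<forall>i\<in>U. \<forall>j\<in>-T - U. \<bar>c $ j\<bar> \<le> \<bar>c $ i\<bar>"
    using exists_top_subset[of "- T" s "\<lambda>i. \<bar>c $ i\<bar>"] by auto
  \<comment> \<open>The sparse minimizer of the functional over the polytope.\<close>
  define w where "w = (\<chi> i. if i \<in> U then - \<alpha> * sgn (c $ i) else 0)"
  have ww: "w $ i = (if i \<in> U then - \<alpha> * sgn (c $ i) else 0)" for i by (simp add: w_def)
  have "(norm w)\<^sup>2 \<le> (\<Sum>i\<in>UNIV. if i \<in> U then \<alpha>\<^sup>2 else 0)"
    unfolding power2_norm_vec
    by (intro sum_mono) (auto simp: ww power_mult_distrib sgn_if)
  also have "\<dots> \<le> real s * \<alpha>\<^sup>2" using U by (simp add: sum.If_cases mult_right_mono)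
  finally have nw: "(norm w)\<^sup>2 \<le> (norm h0)\<^sup>2" using \<alpha>2 by linarith
  have "- \<delta> * (norm h0)\<^sup>2 \<le> (A *v h0) \<bullet> (A *v w)"
    by (rule RIP_disjoint_inner_ge[OF rip \<delta>(1) T(1) U(2)])
      (use U(1) nw in \<open>auto simp: h0_def restrict_vec_def ww\<close>)
  also have "\<dots> \<le> (A *v h0) \<bullet> (A *v h1)"
  proof -
    have "- (\<Sum>i\<in>UNIV. c $ i * h1 $ i) \<le> (\<Sum>i\<in>UNIV. if i \<in> -T then \<bar>c $ i\<bar> * \<bar>h $ i\<bar> else 0)"
      unfolding sum_negf[symmetric]
      by (intro sum_mono) (auto simp: h1_def restrict_vec_def abs_mult[symmetric])
    also have "\<dots> = (\<Sum>i\<in>-T. \<bar>c $ i\<bar> * \<bar>h $ i\<bar>)"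
      by (simp add: sum.If_cases Compl_eq)
    also have "\<dots> \<le> (\<Sum>i\<in>U. \<bar>c $ i\<bar> * \<alpha>)"
      by (rule weighted_sum_le_top_sum[where s = s]) (use U tail_le cone' s\<alpha> in auto)
    also have "\<dots> = (\<Sum>i\<in>UNIV. if i \<in> U then \<bar>c $ i\<bar> * \<alpha> else 0)"
      by (simp add: sum.If_cases Compl_eq)
    also have "\<dots> = - (\<Sum>i\<in>UNIV. c $ i * w $ i)"
      unfolding sum_negf[symmetric] by (intro sum.cong) (auto simp: ww abs_sgn)
    finally show ?thesis unfolding cw by linarith
  qed
  finally have cross: "- \<delta> * (norm h0)\<^sup>2 \<le> (A *v h0) \<bullet> (A *v h1)" .
  have "sparse_vec (2 * s) h0"
  proof -
    have "card {i. h0 $ i \<noteq> 0} \<le> card T"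
      by (intro card_mono) (auto simp: h0_def restrict_vec_def)
    then show ?thesis using T by (simp add: sparse_vec_def)
  qed
  then have rip0: "(1 - \<delta>) * (norm h0)\<^sup>2 \<le> (norm (A *v h0))\<^sup>2"
      "(norm (A *v h0))\<^sup>2 \<le> (1 + \<delta>) * (norm h0)\<^sup>2"
    using rip by (auto simp: rip_bound_def)
  have Ah0: "norm (A *v h0) \<le> sqrt (1 + \<delta>) * norm h0"
    using real_sqrt_le_mono[OF rip0(2)] by (simp add: real_sqrt_mult)
  have Ah: "norm (A *v h) \<le> 2 * \<xi>"
  proof -
    have "A *v h = (A *v g - b) - (A *v z - b)" by (simp add: h_def matrix_vector_mult_diff_distrib)
    then have "norm (A *v h) \<le> norm (A *v g - b) + norm (A *v z - b)" by (metis norm_triangle_ineq4)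
    then show ?thesis using feas sol by (auto simp: l1_solution_def)
  qed
  have "(1 - 2 * \<delta>) * (norm h0)\<^sup>2 \<le> (A *v h0) \<bullet> (A *v h)"
    using rip0(1) cross
    by (simp add: hsum matrix_vector_right_distrib inner_add_right power2_norm_eq_inner algebra_simps)
  also have "\<dots> \<le> norm (A *v h0) * norm (A *v h)" by (rule norm_cauchy_schwarz)
  also have "\<dots> \<le> (sqrt (1 + \<delta>) * norm h0) * (2 * \<xi>)"
    using Ah0 Ah \<delta> by (intro mult_mono) auto
  finally have "(1 - 2 * \<delta>) * norm h0 \<le> 2 * sqrt (1 + \<delta>) * \<xi>"
  proof (cases "norm h0 = 0")
    case True
    have "0 \<le> \<xi>" using feas norm_ge_zero order_trans by blast
    then show ?thesis using True \<delta> by simp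
  next
    case False
    assume "(1 - 2 * \<delta>) * (norm h0)\<^sup>2 \<le> sqrt (1 + \<delta>) * norm h0 * (2 * \<xi>)"
    then have "norm h0 * ((1 - 2 * \<delta>) * norm h0) \<le> norm h0 * (2 * sqrt (1 + \<delta>) * \<xi>)"
      by (simp add: power2_eq_square algebra_simps)
    then show ?thesis using False by simp
  qed
  then have "norm h0 \<le> 2 * sqrt (1 + \<delta>) / (1 - 2 * \<delta>) * \<xi>"
    using \<delta> by (simp add: field_simps)
  moreover have "norm h \<le> norm h0 + norm h1" unfolding hsum by (rule norm_triangle_ineq)
  moreover have "norm h1 \<le> norm h0" using h1_le by (simp add: power2_le_iff_abs_le)
  ultimately have "norm (g - z) \<le> 2 * (2 * sqrt (1 + \<delta>) / (1 - 2 * \<delta>) * \<xi>)"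
    unfolding h_def by linarith
  then show ?thesis by simp
qed


section \<open>Accuracy of the first-order models\<close>

lemma norm_mult_vec_le_of_rows:
  fixes A :: "real^'n^'m"
  assumes "\<And>i. norm (A $ i) \<le> e"
  shows "norm (A *v w) \<le> real CARD('m) * e * norm w"
proof -
  have "norm (A *v w) \<le> (\<Sum>i\<in>UNIV. \<bar>(A *v w) $ i\<bar>)" by (rule norm_le_l1_cart)
  also have "\<dots> \<le> (\<Sum>i\<in>(UNIV :: 'm set). e * norm w)"
  proof (rule sum_mono)
    fix i
    have "\<bar>(A *v w) $ i\<bar> \<le> norm (A $ i) * norm w"
      unfolding matrix_vector_mul_component by (rule Cauchy_Schwarz_ineq2)
    also have "\<dots> \<le> e * norm w" using assms by (intro mult_right_mono) auto
    finally show "\<bar>(A *v w) $ i\<bar> \<le> e * norm w" .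
  qed
  finally show ?thesis by (simp add: algebra_simps)
qed

lemma inner_transpose_mult_vec: "(transpose A *v y) \<bullet> w = y \<bullet> (A *v w)" for A :: "real^'n^'m"
  by (simp add: dot_lmul_matrix)

lemma norm_transpose_mult_vec_le:
  fixes A :: "real^'n^'m"
  assumes "\<And>w. norm (A *v w) \<le> K * norm w"
  shows "norm (transpose A *v y) \<le> K * norm y"
proof (cases "transpose A *v y = 0")
  case True
  have "0 \<le> K * norm (axis undefined 1 :: real^'n)" using assms norm_ge_zero order_trans by blast
  then show ?thesis unfolding True by simp
next
  case False
  let ?z = "transpose A *v y"
  have "norm ?z * norm ?z = y \<bullet> (A *v ?z)"
    by (metis inner_transpose_mult_vec power2_norm_eq_inner power2_eq_square)
  also have "\<dots> \<le> norm y * norm (A *v ?z)" by (rule norm_cauchy_schwarz)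
  also have "\<dots> \<le> norm y * (K * norm ?z)" using assms by (intro mult_left_mono) auto
  finally have "norm ?z * norm ?z \<le> norm ?z * (K * norm y)" by (simp add: algebra_simps)
  then show ?thesis using False mult_le_cancel_left_pos[of "norm ?z"] by simp
qed

lemma transpose_diff: "transpose (A - B) = transpose A - transpose B" for A B :: "real^'n^'m"
  by (simp add: transpose_def vec_eq_iff)

lemma spectral_norm_mult_vec_le: "norm (A *v w) \<le> spectral_norm A * norm w"
  for A :: "real^'n^'m"
  unfolding spectral_norm_def by (rule onorm[OF matrix_vector_mul_bounded_linear])

lemma row_eq_nth: "row i A = A $ i"
  by (simp add: row_def vec_eq_iff)

text \<open>
  The comparison function \<open>\<psi>\<close> below is nonincreasing on the segment, since its derivative is the
  change of the directional derivative minus its Lipschitz bound. The factor \<open>1 / 2\<close> matters: it makes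
  the true gradient feasible for the \<open>l1\<close> problem.
\<close>
lemma component_taylor:
  fixes F :: "real^'n \<Rightarrow> real^'m"
  assumes C1: "C1_map F"
    and lip: "\<And>x y. norm (row i (jacobian F (at x)) - row i (jacobian F (at y))) \<le> \<kappa> * norm (x - y)"
  shows "\<bar>F (x + h) $ i - F x $ i - (jacobian F (at x) *v h) $ i\<bar> \<le> \<kappa> / 2 * (norm h)\<^sup>2"
proof -
  define \<phi> where "\<phi> t = F (x + t *\<^sub>R h) $ i" for t
  define \<phi>' where "\<phi>' t = (jacobian F (at (x + t *\<^sub>R h)) *v h) $ i" for t
  have deriv: "(\<phi> has_real_derivative \<phi>' t) (at t)" for t
  proof -
    have F: "(F has_derivative (\<lambda>w. jacobian F (at (x + t *\<^sub>R h)) *v w)) (at (x + t *\<^sub>R h))"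
      using C1 unfolding C1_map_def by (simp add: jacobian_works)
    have line: "((\<lambda>t. x + t *\<^sub>R h) has_derivative (\<lambda>s. s *\<^sub>R h)) (at t)"
      by (auto intro!: derivative_eq_intros)
    have "((\<lambda>t. F (x + t *\<^sub>R h)) has_derivative
        (\<lambda>s. jacobian F (at (x + t *\<^sub>R h)) *v (s *\<^sub>R h))) (at t)"
      by (rule has_derivative_compose[OF line F])
    then have "(\<phi> has_derivative (\<lambda>s. (jacobian F (at (x + t *\<^sub>R h)) *v (s *\<^sub>R h)) $ i)) (at t)"
      unfolding \<phi>_def by (rule bounded_linear.has_derivative[OF bounded_linear_vec_nth])
    then show ?thesis
      unfolding has_field_derivative_def \<phi>'_def
      by (simp add: matrix_vector_mult_scaleR mult.commute[of _ "(_ *v _) $ _"])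
  qed
  have grow: "\<bar>\<phi>' t - \<phi>' 0\<bar> \<le> \<kappa> * t * (norm h)\<^sup>2" if "0 \<le> t" for t
  proof -
    have "\<phi>' t - \<phi>' 0 =
        (row i (jacobian F (at (x + t *\<^sub>R h))) - row i (jacobian F (at x))) \<bullet> h"
      by (simp add: \<phi>'_def matrix_vector_mul_component row_eq_nth inner_diff_left)
    also have "\<bar>\<dots>\<bar> \<le> norm (row i (jacobian F (at (x + t *\<^sub>R h))) - row i (jacobian F (at x))) * norm h"
      by (rule Cauchy_Schwarz_ineq2)
    also have "\<dots> \<le> (\<kappa> * norm ((x + t *\<^sub>R h) - x)) * norm h"
      by (intro mult_right_mono lip) auto
    finally show ?thesis using that by (simp add: power2_eq_square algebra_simps)
  qed
  have bound: "e * (\<phi> 1 - \<phi> 0 - \<phi>' 0) \<le> \<kappa> / 2 * (norm h)\<^sup>2" if e: "e = 1 \<or> e = -1" for e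
  proof -
    define \<psi> where "\<psi> t = e * (\<phi> t - \<phi> 0 - t * \<phi>' 0) - \<kappa> / 2 * t\<^sup>2 * (norm h)\<^sup>2" for t
    have "\<psi> 1 \<le> \<psi> 0"
    proof (rule DERIV_nonpos_imp_nonincreasing[where f = \<psi>])
      fix t :: real assume t: "0 \<le> t" "t \<le> 1"
      have "(\<psi> has_real_derivative (e * (\<phi>' t - \<phi>' 0) - \<kappa> * t * (norm h)\<^sup>2)) (at t)"
        unfolding \<psi>_def by (auto intro!: derivative_eq_intros deriv)
      moreover have "e * (\<phi>' t - \<phi>' 0) - \<kappa> * t * (norm h)\<^sup>2 \<le> 0"
        using grow[OF t(1)] e by auto
      ultimately show "\<exists>y. (\<psi> has_real_derivative y) (at t) \<and> y \<le> 0" by blast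
    qed simp
    then show ?thesis by (simp add: \<psi>_def)
  qed
  have "\<bar>\<phi> 1 - \<phi> 0 - \<phi>' 0\<bar> \<le> \<kappa> / 2 * (norm h)\<^sup>2"
    using bound[of 1] bound[of "-1"] unfolding abs_le_iff by simp
  then show ?thesis by (simp add: \<phi>_def \<phi>'_def)
qed

lemma taylor_norm:
  fixes F :: "real^'n \<Rightarrow> real^'m"
  assumes "C1_map F"
    and "\<And>i x y. norm (row i (jacobian F (at x)) - row i (jacobian F (at y))) \<le> \<kappa> * norm (x - y)"
  shows "norm (F (x + h) - F x - jacobian F (at x) *v h) \<le> real CARD('m) * \<kappa> / 2 * (norm h)\<^sup>2"
proof -
  have "norm (F (x + h) - F x - jacobian F (at x) *v h)
      \<le> (\<Sum>i\<in>UNIV. \<bar>(F (x + h) - F x - jacobian F (at x) *v h) $ i\<bar>)"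
    by (rule norm_le_l1_cart)
  also have "\<dots> \<le> (\<Sum>i\<in>(UNIV :: 'm set). \<kappa> / 2 * (norm h)\<^sup>2)"
    using component_taylor[OF assms] by (intro sum_mono) auto
  finally show ?thesis by simp
qed

text \<open>
  The tolerance is exactly the bound that Taylor's formula gives on the residual of the true
  gradient, so that gradient is feasible and recovery applies. The constant is \<open>4 * sqrt (1 + \<delta>) / (1 - 2 * \<delta>)\<close> at
  \<open>\<delta> = 0.4931\<close>, rounded up.
\<close>
lemma l1_model_error:
  fixes F :: "real^'n \<Rightarrow> real^'m" and A :: "real^'n^'p"
  assumes C1: "C1_map F"
    and lip: "\<And>x y. norm (row i (jacobian F (at x)) - row i (jacobian F (at y))) \<le> \<kappa> * norm (x - y)"
    and sparse: "sparse_vec s (row i (jacobian F (at x)))"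
    and s: "1 \<le> s" and \<kappa>: "0 < \<kappa>" and \<sigma>: "0 < \<sigma>"
    and rip: "RIP_matrix s A" and bv: "\<And>j. norm (A $ j) \<le> b"
    and sol: "l1_solution A ((1 / \<sigma>) *\<^sub>R diff_vec F x \<sigma> A i) (sqrt (real CARD('p)) * \<kappa> * b\<^sup>2 * \<sigma> / 2) g"
  shows "norm (g - row i (jacobian F (at x))) \<le> 355 * (sqrt (real CARD('p)) * \<kappa> * b\<^sup>2 * \<sigma> / 2)"
proof -
  let ?z = "row i (jacobian F (at x))" and ?\<xi> = "sqrt (real CARD('p)) * \<kappa> * b\<^sup>2 * \<sigma> / 2"
  let ?r = "A *v ?z - (1 / \<sigma>) *\<^sub>R diff_vec F x \<sigma> A i"
  have comp: "\<bar>?r $ j\<bar> \<le> \<kappa> * b\<^sup>2 * \<sigma> / 2" for j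
  proof -
    let ?t = "F (x + \<sigma> *\<^sub>R (A $ j)) $ i - F x $ i - (jacobian F (at x) *v (\<sigma> *\<^sub>R (A $ j))) $ i"
    have lin: "(jacobian F (at x) *v (\<sigma> *\<^sub>R (A $ j))) $ i = \<sigma> * (A $ j \<bullet> ?z)"
      by (simp add: matrix_vector_mul_component row_eq_nth inner_commute)
    have "?r $ j = - (?t / \<sigma>)"
      using \<sigma> unfolding lin by (simp add: matrix_vector_mul_component diff_vec_def field_simps)
    then have "\<bar>?r $ j\<bar> = \<bar>?t\<bar> / \<sigma>" using \<sigma> by simp
    also have "\<dots> \<le> (\<kappa> / 2 * (norm (\<sigma> *\<^sub>R (A $ j)))\<^sup>2) / \<sigma>"
      using component_taylor[OF C1 lip, of x "\<sigma> *\<^sub>R (A $ j)"] \<sigma> by (intro divide_right_mono) auto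
    also have "\<dots> = \<kappa> / 2 * \<sigma> * (norm (A $ j))\<^sup>2"
      using \<sigma> by (simp add: power2_eq_square field_simps)
    also have "\<dots> \<le> \<kappa> / 2 * \<sigma> * b\<^sup>2"
      using bv \<kappa> \<sigma> by (intro mult_left_mono power_mono) auto
    finally show ?thesis by (simp add: algebra_simps)
  qed
  have feas: "norm ?r \<le> ?\<xi>"
  proof (rule power2_le_imp_le)
    have "(norm ?r)\<^sup>2 \<le> (\<Sum>j\<in>(UNIV :: 'p set). (\<kappa> * b\<^sup>2 * \<sigma> / 2)\<^sup>2)"
      unfolding power2_norm_vec using comp
      by (intro sum_mono) (metis abs_ge_zero power2_abs power_mono)
    also have "\<dots> = ?\<xi>\<^sup>2" by (simp add: power_mult_distrib power_divide)
    finally show "(norm ?r)\<^sup>2 \<le> ?\<xi>\<^sup>2" .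
    show "0 \<le> ?\<xi>" using \<kappa> \<sigma> by simp
  qed
  have "rip_bound (2 * s) A (rip_constant (2 * s) A)" using s by (intro rip_constant_least) simp
  moreover have "rip_constant (2 * s) A \<le> 0.4931" using rip by (simp add: RIP_matrix_def)
  ultimately have "rip_bound (2 * s) A 0.4931"
    unfolding rip_bound_def by (smt (verit) mult_right_mono zero_le_power2)
  from l1_recovery[OF this _ _ s sparse feas sol]
  have "norm (g - ?z) \<le> 4 * sqrt (1 + 0.4931) / (1 - 2 * 0.4931) * ?\<xi>" by simp
  also have "\<dots> \<le> 355 * ?\<xi>"
  proof (rule mult_right_mono)
    have "sqrt (1 + 0.4931) \<le> 1.223" by (rule real_le_lsqrt) (simp_all add: power2_eq_square)
    then show "4 * sqrt (1 + 0.4931) / (1 - 2 * 0.4931) \<le> (355 :: real)" by (simp add: field_simps)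
    show "0 \<le> ?\<xi>" using \<kappa> \<sigma> by simp
  qed
  finally show ?thesis .
qed


section \<open>A single realization\<close>

lemma summable_contraction:
  fixes a b :: "nat \<Rightarrow> real"
  assumes a: "\<And>k. 0 \<le> a k" and q: "q < 1"
    and step: "\<And>k. a (Suc k) \<le> q * a k + b k" and b: "\<And>n. (\<Sum>k<n. b k) \<le> B"
  shows "summable a"
proof (rule summableI_nonneg_bounded[OF a])
  fix n
  have "(\<Sum>k<n. a k) \<le> (\<Sum>k<Suc n. a k)" using a by simp
  also have "\<dots> = a 0 + (\<Sum>k<n. a (Suc k))" by (rule sum.lessThan_Suc_shift)
  also have "(\<Sum>k<n. a (Suc k)) \<le> (\<Sum>k<n. q * a k + b k)" by (intro sum_mono step)
  also have "\<dots> \<le> q * (\<Sum>k<n. a k) + B" using b by (simp add: sum.distrib sum_distrib_left)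
  finally have "(1 - q) * (\<Sum>k<n. a k) \<le> a 0 + B" by (simp add: algebra_simps)
  then show "(\<Sum>k<n. a k) \<le> (a 0 + B) / (1 - q)" using q by (simp add: pos_le_divide_eq mult.commute)
qed

text \<open>
  Think of \<open>y\<close> as a Lipschitz function along a path with step lengths \<open>r\<close>. Past an index after which
  single steps and the total length of the stretches with \<open>y \<ge> \<epsilon>\<close> are below \<open>\<epsilon> / L\<close>, a stretch
  that starts from a value below \<open>\<epsilon>\<close> can add at most \<open>2 * \<epsilon>\<close>.
\<close>
lemma tendsto_zero_of_summable_excursions:
  fixes y r :: "nat \<Rightarrow> real"
  assumes y: "\<And>k. 0 \<le> y k" and r: "\<And>k. 0 \<le> r k" and L: "0 < L"
    and step: "\<And>j k. j \<le> k \<Longrightarrow> \<bar>y k - y j\<bar> \<le> L * (\<Sum>i\<in>{j..<k}. r i)"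
    and r0: "r \<longlonglongrightarrow> 0"
    and small: "\<And>\<epsilon> K. 0 < \<epsilon> \<Longrightarrow> \<exists>k\<ge>K. y k < \<epsilon>"
    and summ: "\<And>\<epsilon>. 0 < \<epsilon> \<Longrightarrow> summable (\<lambda>k. if \<epsilon> \<le> y k then r k else 0)"
  shows "y \<longlonglongrightarrow> 0"
proof (rule LIMSEQ_I)
  fix e :: real assume "0 < e"
  define \<epsilon> where "\<epsilon> = e / 3"
  have \<epsilon>: "0 < \<epsilon>" using \<open>0 < e\<close> by (simp add: \<epsilon>_def)
  let ?b = "\<lambda>k. if \<epsilon> \<le> y k then r k else 0"
  from \<epsilon> L have \<delta>: "0 < \<epsilon> / L" by simp
  obtain K1 where K1: "\<And>k. k \<ge> K1 \<Longrightarrow> r k < \<epsilon> / L"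
    using LIMSEQ_D[OF r0 \<delta>] r by auto
  obtain K2 where K2: "\<And>m n. m \<ge> K2 \<Longrightarrow> norm (sum ?b {m..<n}) < \<epsilon> / L"
    using summ[OF \<epsilon>] \<delta> unfolding summable_Cauchy by blast
  obtain k0 where k0: "k0 \<ge> max K1 K2" "y k0 < \<epsilon>" using small[OF \<epsilon>] by blast
  have "y k < e" if k: "k \<ge> k0" for k
  proof (cases "y k < \<epsilon>")
    case True
    then show ?thesis using \<open>0 < e\<close> by (simp add: \<epsilon>_def)
  next
    case False
    \<comment> \<open>\<open>l\<close> is the last index up to \<open>k\<close> with a small value.\<close>
    define l where "l = Max {i. k0 \<le> i \<and> i \<le> k \<and> y i < \<epsilon>}"
    have fin: "finite {i. k0 \<le> i \<and> i \<le> k \<and> y i < \<epsilon>}" by auto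
    have ne: "{i. k0 \<le> i \<and> i \<le> k \<and> y i < \<epsilon>} \<noteq> {}" using k k0 by auto
    have l: "k0 \<le> l" "l \<le> k" "y l < \<epsilon>" using Max_in[OF fin ne] by (auto simp: l_def)
    have big: "\<epsilon> \<le> y i" if "l < i" "i \<le> k" for i
      using Max_ge[OF fin, of i] that l unfolding l_def[symmetric] by (cases "y i < \<epsilon>") auto
    have lk: "l < k" using l False by (cases "l = k") auto
    have "\<bar>y k - y l\<bar> \<le> L * (\<Sum>i\<in>{l..<k}. r i)" using step l by auto
    also have "(\<Sum>i\<in>{l..<k}. r i) = r l + (\<Sum>i\<in>{Suc l..<k}. r i)"
      using lk by (rule sum.atLeast_Suc_lessThan)
    also have "(\<Sum>i\<in>{Suc l..<k}. r i) = sum ?b {Suc l..<k}"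
      using big by (intro sum.cong) auto
    finally have "\<bar>y k - y l\<bar> \<le> L * (r l + sum ?b {Suc l..<k})" .
    also have "\<dots> \<le> L * (\<epsilon> / L + \<epsilon> / L)"
      using K1[of l] K2[of "Suc l" k] l k0 L by (intro mult_left_mono add_mono) auto
    also have "\<dots> = 2 * \<epsilon>" using L by simp
    finally have "y k - y l \<le> 2 * \<epsilon>" by linarith
    then show ?thesis using l by (simp add: \<epsilon>_def)
  qed
  then show "\<exists>no. \<forall>n\<ge>no. norm (y n - 0) < e" using y by auto
qed

text \<open>
  The gradient of \<open>\<parallel>F\<parallel>\<^sup>2 / 2\<close>.
\<close>
definition objective_grad :: "(real^'n \<Rightarrow> real^'m) \<Rightarrow> real^'n \<Rightarrow> real^'n" where
  "objective_grad F y = transpose (jacobian F (at y)) *v F y"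

locale lm_run =
  fixes F :: "real^'n \<Rightarrow> real^'m"
    and \<eta>0 \<eta>1 \<eta>2 \<gamma>1 \<gamma>2 \<theta>min \<theta>0 \<kappa>lg \<kappa>bv :: real
    and s :: nat and x0 :: "real^'n"
    and \<sigma> \<xi> :: "nat \<Rightarrow> real" and v :: "nat \<Rightarrow> real^'n^'p"
    and x :: "nat \<Rightarrow> real^'n" and \<theta> :: "nat \<Rightarrow> real" and J :: "nat \<Rightarrow> real^'n^'m" and d :: "nat \<Rightarrow> real^'n"
  assumes s: "1 \<le> s"
    and \<eta>: "0 < \<eta>0" "\<eta>0 < 1" "0 < \<eta>1" "\<eta>1 < \<eta>2"
    and \<gamma>: "0 < \<gamma>1" "\<gamma>1 < 1" "1 < \<gamma>2"
    and \<theta>min: "0 < \<theta>min" "\<theta>min \<le> \<theta>0"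
    and C1: "C1_map F"
    and lg: "0 < \<kappa>lg"
      "\<And>i x y. norm (row i (jacobian F (at x)) - row i (jacobian F (at y))) \<le> \<kappa>lg * norm (x - y)"
    and sparse: "\<And>i x. sparse_vec s (row i (jacobian F (at x)))"
    and compact: "compact (enlarged_level_set F x0 \<theta>min)"
    and lf: "\<exists>\<kappa>lf>0. \<forall>x\<in>enlarged_level_set F x0 \<theta>min. \<forall>y\<in>enlarged_level_set F x0 \<theta>min.
      norm (F y - F x) \<le> \<kappa>lf * norm (y - x)"
    and run: "lm_realization F \<eta>0 \<eta>1 \<eta>2 \<gamma>1 \<gamma>2 \<theta>min x0 \<theta>0 \<sigma> \<xi> v x \<theta> J d"
    and sigma: "\<And>k. \<sigma> (Suc k) = norm (d k)"
    and xi: "\<And>k. \<xi> k = sqrt (real CARD('p)) * \<kappa>lg * \<kappa>bv\<^sup>2 * \<sigma> k / 2"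
    and model_bounded: "\<exists>\<kappa>>0. \<forall>k. spectral_norm (J k) \<le> \<kappa>"
begin

definition g :: "nat \<Rightarrow> real^'n" where "g k = transpose (J k) *v F (x k)"

definition G :: "nat \<Rightarrow> real" where "G k = norm (g k)"

definition \<rho> :: "nat \<Rightarrow> real" where "\<rho> k = reduction_ratio F (x k) (J k) (d k)"

text \<open>
  The denominator of the reduction ratio: the decrease of \<open>\<parallel>F\<parallel>\<^sup>2\<close> in the linear model of \<open>F\<close>.
\<close>
definition predicted :: "nat \<Rightarrow> real" where
  "predicted k = (norm (F (x k)))\<^sup>2 - (norm (F (x k) + J k *v d k))\<^sup>2"

definition sq_residual :: "nat \<Rightarrow> real" where "sq_residual k = (norm (F (x k)))\<^sup>2"

definition good :: "nat \<Rightarrow> bool" where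
  "good k \<longleftrightarrow> RIP_matrix s (v k) \<and> (\<forall>j. norm (v k $ j) \<le> \<kappa>bv)"

definition grad_norm :: "nat \<Rightarrow> real" where "grad_norm k = norm (objective_grad F (x k))"

lemma x_0: "x 0 = x0" and \<theta>_0: "\<theta> 0 = \<theta>0"
  using run by (auto simp: lm_realization_def)

lemma \<sigma>_pos: "0 < \<sigma> k"
  and l1_sol: "l1_solution (v k) ((1 / \<sigma> k) *\<^sub>R diff_vec F (x k) (\<sigma> k) (v k) i) (\<xi> k) (J k $ i)"
  and g_nonzero: "g k \<noteq> 0"
  and linear_system: "(transpose (J k) ** J k + (\<theta> k * G k) *\<^sub>R mat 1) *v d k = - g k"
  and x_Suc: "x (Suc k) = (if \<eta>0 \<le> \<rho> k then x k + d k else x k)"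
  and \<theta>_Suc: "\<theta> (Suc k) = theta_update \<eta>0 \<eta>1 \<eta>2 \<gamma>1 \<gamma>2 \<theta>min (\<rho> k) (G k) (\<theta> k)"
  using run unfolding lm_realization_def Let_def g_def[symmetric] G_def[symmetric] \<rho>_def[symmetric]
  by blast+

lemma G_pos: "0 < G k"
  using g_nonzero by (simp add: G_def)

lemma \<theta>_ge_min: "\<theta>min \<le> \<theta> k"
proof (induction k)
  case 0
  then show ?case using \<theta>min \<theta>_0 by simp
next
  case (Suc k)
  have "1 * \<theta> k \<le> \<gamma>2 * \<theta> k" using \<gamma> \<theta>min Suc by (intro mult_right_mono) auto
  then show ?case using Suc by (auto simp: \<theta>_Suc theta_update_def)
qed

lemma \<theta>_pos: "0 < \<theta> k"
  using \<theta>_ge_min[of k] \<theta>min by linarith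

lemma \<theta>_Suc_le: "\<theta> (Suc k) \<le> \<gamma>2 * \<theta> k"
proof -
  have "1 * \<theta> k \<le> \<gamma>2 * \<theta> k" "\<gamma>1 * \<theta> k \<le> 1 * \<theta> k"
    using \<gamma> \<theta>_pos[of k] by (intro mult_right_mono; simp)+
  then show ?thesis using \<theta>_ge_min[of k] by (auto simp: \<theta>_Suc theta_update_def)
qed

lemma \<theta>_Suc_ge: "\<gamma>1 * \<theta> k \<le> \<theta> (Suc k)"
proof -
  have "1 * \<theta> k \<le> \<gamma>2 * \<theta> k" "\<gamma>1 * \<theta> k \<le> 1 * \<theta> k"
    using \<gamma> \<theta>_pos[of k] by (intro mult_right_mono; simp)+
  then show ?thesis by (auto simp: \<theta>_Suc theta_update_def)
qed

lemma step_eq: "transpose (J k) *v (J k *v d k) + (\<theta> k * G k) *\<^sub>R d k = - g k"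
  using linear_system[of k]
  by (simp add: matrix_vector_mult_add_rdistrib matrix_vector_mul_assoc[symmetric]
      scaleR_matrix_vector_assoc[symmetric] del: transpose_matrix_vector)

lemma g_inner_d: "- (g k \<bullet> d k) = (norm (J k *v d k))\<^sup>2 + \<theta> k * G k * (norm (d k))\<^sup>2"
proof -
  have "- (g k \<bullet> d k) = (transpose (J k) *v (J k *v d k) + (\<theta> k * G k) *\<^sub>R d k) \<bullet> d k"
    unfolding step_eq by simp
  then show ?thesis
    by (simp only: inner_add_left inner_transpose_mult_vec inner_scaleR_left power2_norm_eq_inner)
qed

text \<open>
  Pairing the linear system with \<open>d\<close> gives \<open>\<theta> G \<parallel>d\<parallel>\<^sup>2 \<le> G \<parallel>d\<parallel>\<close>: the choice of \<open>\<lambda> = \<theta> G\<close>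
  turns \<open>1 / \<theta>\<close> into a trust region radius.
\<close>
lemma norm_d_le: "norm (d k) \<le> 1 / \<theta> k"
proof (cases "d k = 0")
  case True
  then show ?thesis using \<theta>_pos[of k] by simp
next
  case False
  have "\<theta> k * G k * (norm (d k))\<^sup>2 \<le> - (g k \<bullet> d k)" unfolding g_inner_d by simp
  also have "\<dots> \<le> G k * norm (d k)"
    unfolding G_def using norm_cauchy_schwarz[of "- g k" "d k"] by simp
  finally have "(G k * norm (d k)) * (\<theta> k * norm (d k)) \<le> (G k * norm (d k)) * 1"
    by (simp add: power2_eq_square algebra_simps)
  then have "\<theta> k * norm (d k) \<le> 1" using False G_pos[of k] by simp
  then show ?thesis using \<theta>_pos[of k] by (simp add: field_simps)
qed

lemma predicted_eq: "predicted k = (norm (J k *v d k))\<^sup>2 + 2 * (\<theta> k * G k * (norm (d k))\<^sup>2)"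
proof -
  have "(norm (F (x k) + J k *v d k))\<^sup>2
      = (norm (F (x k)))\<^sup>2 + 2 * (F (x k) \<bullet> (J k *v d k)) + (norm (J k *v d k))\<^sup>2"
    by (simp add: power2_norm_eq_inner inner_simps inner_commute)
  also have "F (x k) \<bullet> (J k *v d k) = g k \<bullet> d k"
    unfolding g_def inner_transpose_mult_vec ..
  finally show ?thesis unfolding predicted_def using g_inner_d[of k] by linarith
qed

lemma model_bound:
  obtains \<kappa> where "0 < \<kappa>" "\<And>k w. norm (J k *v w) \<le> \<kappa> * norm w"
proof -
  obtain \<kappa> where \<kappa>: "0 < \<kappa>" "\<And>k. spectral_norm (J k) \<le> \<kappa>" using model_bounded by blast
  have "norm (J k *v w) \<le> \<kappa> * norm w" for k w
    using spectral_norm_mult_vec_le[of "J k" w] mult_right_mono[OF \<kappa>(2)[of k], of "norm w"] by simp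
  with \<kappa>(1) show ?thesis by (rule that)
qed

text \<open>
  By the linear system \<open>G\<close> is at most \<open>\<kappa> a + l b\<close>, where \<open>a = \<parallel>J d\<parallel>\<close>,
  \<open>b = \<parallel>d\<parallel>\<close> and \<open>l = \<theta> G\<close>, and \<open>a\<^sup>2 + l b\<^sup>2\<close> is at most the predicted decrease. The
  Cauchy--Schwarz inequality with weights \<open>1\<close> and \<open>l\<close> connects the two.
\<close>
lemma predicted_ge:
  assumes \<kappa>: "0 < \<kappa>" "\<And>w. norm (J k *v w) \<le> \<kappa> * norm w"
  shows "(G k)\<^sup>2 \<le> (\<kappa>\<^sup>2 + \<theta> k * G k) * predicted k"
proof -
  define a b l where "a = norm (J k *v d k)" and "b = norm (d k)" and "l = \<theta> k * G k"
  have l: "0 \<le> l" using \<theta>_pos[of k] G_pos[of k] by (simp add: l_def)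
  have "G k = norm (transpose (J k) *v (J k *v d k) + l *\<^sub>R d k)"
    unfolding l_def step_eq by (simp add: G_def)
  also have "\<dots> \<le> norm (transpose (J k) *v (J k *v d k)) + norm (l *\<^sub>R d k)" by (rule norm_triangle_ineq)
  also have "\<dots> \<le> \<kappa> * a + l * b"
    unfolding a_def b_def using norm_transpose_mult_vec_le[OF \<kappa>(2)] l by (simp del: transpose_matrix_vector)
  finally have "(G k)\<^sup>2 \<le> (\<kappa> * a + l * b)\<^sup>2" using G_pos[of k] by (intro power_mono) auto
  also have "(\<kappa> * a + l * b)\<^sup>2 + l * (\<kappa> * b - a)\<^sup>2 = (\<kappa>\<^sup>2 + l) * (a\<^sup>2 + l * b\<^sup>2)"
    by (simp add: power2_eq_square algebra_simps)
  then have "(\<kappa> * a + l * b)\<^sup>2 \<le> (\<kappa>\<^sup>2 + l) * (a\<^sup>2 + l * b\<^sup>2)"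
    using l by (smt (verit) mult_nonneg_nonneg zero_le_power2)
  also have "\<dots> \<le> (\<kappa>\<^sup>2 + l) * predicted k"
    unfolding predicted_eq a_def b_def l_def[symmetric] using l by (intro mult_left_mono) auto
  finally show ?thesis by (simp add: l_def)
qed

lemma predicted_pos: "0 < predicted k"
proof -
  obtain \<kappa> where \<kappa>: "0 < \<kappa>" "\<And>k w. norm (J k *v w) \<le> \<kappa> * norm w" using model_bound by blast
  have "0 < (G k)\<^sup>2" using G_pos[of k] by simp
  also have "\<dots> \<le> (\<kappa>\<^sup>2 + \<theta> k * G k) * predicted k" by (rule predicted_ge[OF \<kappa>])
  finally show ?thesis using \<kappa>(1) \<theta>_pos[of k] G_pos[of k]
    by (metis add_pos_pos mult_pos_pos zero_less_mult_pos zero_less_power)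
qed

lemma success_decrease: "\<eta>0 \<le> \<rho> k \<Longrightarrow> \<eta>0 * predicted k \<le> sq_residual k - sq_residual (Suc k)"
  using predicted_pos[of k]
  by (simp add: x_Suc \<rho>_def reduction_ratio_def predicted_def sq_residual_def pos_le_divide_eq)

lemma sq_residual_Suc_le: "sq_residual (Suc k) \<le> sq_residual k"
proof (cases "\<eta>0 \<le> \<rho> k")
  case True
  then show ?thesis
    using success_decrease[OF True] mult_pos_pos[OF \<eta>(1) predicted_pos[of k]] by linarith
qed (simp add: sq_residual_def x_Suc)

lemma sq_residual_le: "sq_residual k \<le> sq_residual 0"
  by (rule decseqD[of sq_residual 0 k]) (auto intro: decseq_SucI sq_residual_Suc_le)

lemma x_in_level_set: "x k \<in> level_set F x0"
  using sq_residual_le[of k] by (simp add: sq_residual_def x_0 level_set_def abs_le_square_iff[symmetric])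

lemma norm_F_le: "norm (F (x k)) \<le> norm (F x0)"
  using x_in_level_set by (simp add: level_set_def)

text \<open>
  In the regime \<open>\<theta> G \<ge> \<eta>1\<close> the regularization dominates the bounded model Hessian up to a constant,
  which gives a decrease of the order of a steepest descent step of length \<open>1 / \<theta>\<close>.
\<close>
lemma predicted_ge_div:
  obtains M where "0 < M" "\<And>k. \<eta>1 \<le> \<theta> k * G k \<Longrightarrow> G k / (M * \<theta> k) \<le> predicted k"
proof -
  obtain \<kappa> where \<kappa>: "0 < \<kappa>" "\<And>k w. norm (J k *v w) \<le> \<kappa> * norm w" using model_bound by blast
  define M where "M = \<kappa>\<^sup>2 / \<eta>1 + 1"
  have M: "0 < M" using \<eta> by (simp add: M_def add_nonneg_pos)
  have "G k / (M * \<theta> k) \<le> predicted k" if "\<eta>1 \<le> \<theta> k * G k" for k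
  proof -
    have "\<kappa>\<^sup>2 = \<kappa>\<^sup>2 / \<eta>1 * \<eta>1" using \<eta> by simp
    also have "\<dots> \<le> \<kappa>\<^sup>2 / \<eta>1 * (\<theta> k * G k)" using that \<eta> by (intro mult_left_mono) auto
    finally have "\<kappa>\<^sup>2 + \<theta> k * G k \<le> M * (\<theta> k * G k)" by (simp add: M_def algebra_simps)
    then have "(\<kappa>\<^sup>2 + \<theta> k * G k) * predicted k \<le> (M * (\<theta> k * G k)) * predicted k"
      using predicted_pos[of k] by (intro mult_right_mono) auto
    with predicted_ge[OF \<kappa>, of k] have "G k * G k \<le> G k * (M * \<theta> k * predicted k)"
      by (simp add: power2_eq_square algebra_simps)
    then have "G k \<le> M * \<theta> k * predicted k" using G_pos[of k] by simp
    then show ?thesis using M \<theta>_pos[of k] by (simp add: field_simps)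
  qed
  with M show ?thesis by (rule that)
qed

lemma sum_sq_residual_diff_le: "(\<Sum>k<n. sq_residual k - sq_residual (Suc k)) \<le> sq_residual 0"
  using sum_lessThan_telescope'[of sq_residual n] by (simp add: sq_residual_def)

lemma summable_sq_residual_diff: "summable (\<lambda>k. sq_residual k - sq_residual (Suc k))"
  by (rule summableI_nonneg_bounded[OF _ sum_sq_residual_diff_le]) (use sq_residual_Suc_le in simp)

text \<open>
  An iteration either multiplies \<open>\<theta>\<close> by \<open>\<gamma>2\<close>, so that \<open>1 / \<theta>\<^sup>2\<close> contracts, or is successful with
  \<open>\<theta> G \<ge> \<eta>1\<close>; then \<open>\<theta>\<close> shrinks at most by \<open>\<gamma>1\<close>, and the new value of \<open>1 / \<theta>\<^sup>2\<close> is bounded by a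
  multiple of the decrease of \<open>\<parallel>F\<parallel>\<^sup>2\<close>, which telescopes.
\<close>
lemma summable_inverse_\<theta>_square: "summable (\<lambda>k. 1 / (\<theta> k)\<^sup>2)"
proof -
  obtain M where M: "0 < M" "\<And>k. \<eta>1 \<le> \<theta> k * G k \<Longrightarrow> G k / (M * \<theta> k) \<le> predicted k"
    using predicted_ge_div by blast
  define C where "C = M / (\<gamma>1\<^sup>2 * \<eta>0 * \<eta>1)"
  have C: "0 < C" using M \<eta> \<gamma> by (simp add: C_def)
  show ?thesis
  proof (rule summable_contraction[where q = "1 / \<gamma>2\<^sup>2" and B = "C * sq_residual 0"
        and b = "\<lambda>k. C * (sq_residual k - sq_residual (Suc k))"])
    show "0 \<le> 1 / (\<theta> k)\<^sup>2" for k by simp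
    show "1 / \<gamma>2\<^sup>2 < 1" using \<gamma> by (simp add: one_less_power)
    show "(\<Sum>k<n. C * (sq_residual k - sq_residual (Suc k))) \<le> C * sq_residual 0" for n
      unfolding sum_distrib_left[symmetric] using C sum_sq_residual_diff_le by (intro mult_left_mono) auto
    show "1 / (\<theta> (Suc k))\<^sup>2 \<le> 1 / \<gamma>2\<^sup>2 * (1 / (\<theta> k)\<^sup>2) + C * (sq_residual k - sq_residual (Suc k))" for k
    proof (cases "\<rho> k < \<eta>0 \<or> G k < \<eta>1 / \<theta> k")
      case True
      then have "\<theta> (Suc k) = \<gamma>2 * \<theta> k" by (auto simp: \<theta>_Suc theta_update_def)
      then show ?thesis using C sq_residual_Suc_le[of k] by (simp add: power_mult_distrib)
    next
      case False
      then have succ: "\<eta>0 \<le> \<rho> k" and \<theta>G: "\<eta>1 \<le> \<theta> k * G k"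
        using \<theta>_pos[of k] by (auto simp: field_simps)
      have "1 / (\<theta> (Suc k))\<^sup>2 \<le> 1 / (\<gamma>1 * \<theta> k)\<^sup>2"
        using \<theta>_Suc_ge[of k] \<theta>_pos[of k] \<gamma>
        by (intro divide_left_mono power_mono mult_pos_pos zero_less_power) (auto simp: \<theta>_pos less_imp_le)
      also have "\<dots> = C * \<eta>0 * (\<eta>1 / \<theta> k / (M * \<theta> k))"
        using M \<eta> by (simp add: C_def power2_eq_square field_simps)
      also have "\<dots> \<le> C * \<eta>0 * (G k / (M * \<theta> k))"
        using \<theta>G M \<theta>_pos[of k] C \<eta>
        by (intro mult_left_mono divide_right_mono) (auto simp: field_simps)
      also have "\<dots> \<le> C * (\<eta>0 * predicted k)"
        using mult_left_mono[OF M(2)[OF \<theta>G], of "C * \<eta>0"] C \<eta> by (simp only: mult.assoc) simp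
      also have "\<dots> \<le> C * (sq_residual k - sq_residual (Suc k))"
        using success_decrease[OF succ] C by (intro mult_left_mono) auto
      finally show ?thesis by (simp add: add_increasing)
    qed
  qed
qed

lemma inverse_\<theta>_tendsto: "(\<lambda>k. 1 / \<theta> k) \<longlonglongrightarrow> 0"
proof -
  have "(\<lambda>k. sqrt (1 / (\<theta> k)\<^sup>2)) \<longlonglongrightarrow> sqrt 0"
    by (intro tendsto_real_sqrt summable_LIMSEQ_zero summable_inverse_\<theta>_square)
  moreover have "sqrt (1 / (\<theta> k)\<^sup>2) = 1 / \<theta> k" for k
    using \<theta>_pos[of k] by (simp add: real_sqrt_divide)
  ultimately show ?thesis by simp
qed

text \<open>
  From the second iteration on, the sampling radius is the previous step length, which is at most
  \<open>1 / \<theta> k \<le> \<gamma>2 / \<theta> (Suc k)\<close>.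
\<close>
lemma model_error:
  obtains E where "0 \<le> E"
    "\<And>k w. good (Suc k) \<Longrightarrow>
       norm ((J (Suc k) - jacobian F (at (x (Suc k)))) *v w) \<le> E / \<theta> (Suc k) * norm w"
proof -
  define c where "c = 355 * (sqrt (real CARD('p)) * \<kappa>lg * \<kappa>bv\<^sup>2 / 2)"
  have c: "0 \<le> c" using lg by (simp add: c_def)
  have "norm ((J (Suc k) - jacobian F (at (x (Suc k)))) *v w)
      \<le> (real CARD('m) * c * \<gamma>2) / \<theta> (Suc k) * norm w" if "good (Suc k)" for k w
  proof -
    have "norm ((J (Suc k) - jacobian F (at (x (Suc k)))) $ i) \<le> c * \<sigma> (Suc k)" for i
    proof -
      have "norm (J (Suc k) $ i - row i (jacobian F (at (x (Suc k)))))
          \<le> 355 * (sqrt (real CARD('p)) * \<kappa>lg * \<kappa>bv\<^sup>2 * \<sigma> (Suc k) / 2)"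
        using that l1_sol[of "Suc k" i] unfolding xi good_def
        by (intro l1_model_error[OF C1 lg(2) sparse s lg(1) \<sigma>_pos, where A = "v (Suc k)"]) auto
      then show ?thesis by (simp add: c_def row_eq_nth algebra_simps)
    qed
    also have "\<sigma> (Suc k) \<le> \<gamma>2 / \<theta> (Suc k)"
    proof -
      have "\<sigma> (Suc k) \<le> 1 / \<theta> k" unfolding sigma by (rule norm_d_le)
      also have "\<dots> \<le> \<gamma>2 / \<theta> (Suc k)"
        using \<theta>_Suc_le[of k] \<theta>_pos[of k] \<theta>_pos[of "Suc k"] by (simp add: field_simps)
      finally show ?thesis .
    qed
    finally have "norm ((J (Suc k) - jacobian F (at (x (Suc k)))) $ i) \<le> c * (\<gamma>2 / \<theta> (Suc k))" for i
      using c by (simp add: mult_left_mono)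
    from norm_mult_vec_le_of_rows[OF this] show ?thesis by (simp add: algebra_simps)
  qed
  moreover have "0 \<le> real CARD('m) * c * \<gamma>2" using c \<gamma> by simp
  ultimately show ?thesis by (rule that[rotated])
qed

text \<open>
  On a good iteration actual and predicted decrease differ by \<open>O(1 / \<theta>\<^sup>2)\<close>, whereas the predicted
  decrease is at least a multiple of \<open>G / \<theta>\<close>; for large \<open>\<theta> G\<close> the
  difference is a small fraction of the latter.
\<close>
lemma success_of_good:
  obtains C where "\<And>k. good (Suc k) \<Longrightarrow> C \<le> \<theta> (Suc k) * G (Suc k) \<Longrightarrow> \<eta>0 \<le> \<rho> (Suc k)"
proof -
  obtain M where M: "0 < M" "\<And>k. \<eta>1 \<le> \<theta> k * G k \<Longrightarrow> G k / (M * \<theta> k) \<le> predicted k"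
    using predicted_ge_div by blast
  obtain E where E: "0 \<le> E" "\<And>k w. good (Suc k) \<Longrightarrow>
       norm ((J (Suc k) - jacobian F (at (x (Suc k)))) *v w) \<le> E / \<theta> (Suc k) * norm w"
    using model_error by blast
  define K where "K = real CARD('m) * \<kappa>lg / 2 + E"
  have K: "0 \<le> K" using lg E by (simp add: K_def)
  define H where "H = K * (2 * norm (F x0) + K / \<theta>min\<^sup>2)"
  have "\<eta>0 \<le> \<rho> (Suc j)" if good: "good (Suc j)"
    and C: "max \<eta>1 (H * M / (1 - \<eta>0)) \<le> \<theta> (Suc j) * G (Suc j)" for j
  proof -
    define k where "k = Suc j"
    note that = good[folded k_def] C[folded k_def]
    define a where "a = F (x k) + J k *v d k"
    define b where "b = F (x k + d k)"
    have t: "0 < \<theta> k" by (rule \<theta>_pos)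
    have d2: "(norm (d k))\<^sup>2 \<le> 1 / (\<theta> k)\<^sup>2"
      using power_mono[OF norm_d_le[of k], of 2] by (simp add: power_divide)
    have "norm (b - a) = norm ((F (x k + d k) - F (x k) - jacobian F (at (x k)) *v d k)
        - (J k - jacobian F (at (x k))) *v d k)"
      by (simp add: a_def b_def matrix_vector_mult_diff_rdistrib algebra_simps)
    also have "\<dots> \<le> norm (F (x k + d k) - F (x k) - jacobian F (at (x k)) *v d k)
        + norm ((J k - jacobian F (at (x k))) *v d k)" by (rule norm_triangle_ineq4)
    also have "\<dots> \<le> real CARD('m) * \<kappa>lg / 2 * (norm (d k))\<^sup>2 + E / \<theta> k * norm (d k)"
      using taylor_norm[OF C1 lg(2)] E(2)[of j] good unfolding k_def by (intro add_mono) auto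
    also have "\<dots> \<le> real CARD('m) * \<kappa>lg / 2 * (1 / (\<theta> k)\<^sup>2) + E / \<theta> k * (1 / \<theta> k)"
      using d2 norm_d_le[of k] lg E t by (intro add_mono mult_left_mono) auto
    also have "\<dots> = K / (\<theta> k)\<^sup>2" by (simp add: K_def power2_eq_square add_divide_distrib)
    finally have ba: "norm (b - a) \<le> K / (\<theta> k)\<^sup>2" .
    have "(norm a)\<^sup>2 \<le> (norm (F (x k)))\<^sup>2" using predicted_pos[of k] unfolding predicted_def a_def by linarith
    then have "norm a \<le> norm (F (x k))" by (rule power2_le_imp_le) simp
    then have na: "norm a \<le> norm (F x0)" using norm_F_le[of k] by linarith
    have ba': "norm (b - a) \<le> K / \<theta>min\<^sup>2"
    proof -
      have "K / (\<theta> k)\<^sup>2 \<le> K / \<theta>min\<^sup>2"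
        using \<theta>_ge_min[of k] \<theta>min t K by (intro divide_left_mono power_mono mult_pos_pos) auto
      with ba show ?thesis by linarith
    qed
    have nb: "norm b \<le> norm a + norm (b - a)" using norm_triangle_ineq[of a "b - a"] by simp
    have "(norm b)\<^sup>2 - (norm a)\<^sup>2 \<le> (norm a + norm (b - a))\<^sup>2 - (norm a)\<^sup>2"
      using nb by (simp add: power_mono)
    also have "\<dots> = norm (b - a) * (2 * norm a + norm (b - a))"
      by (simp add: power2_eq_square algebra_simps)
    also have "\<dots> \<le> (K / (\<theta> k)\<^sup>2) * (2 * norm (F x0) + K / \<theta>min\<^sup>2)"
      using ba ba' na K by (intro mult_mono) auto
    also have "\<dots> = H / (\<theta> k)\<^sup>2" by (simp add: H_def)
    also have "\<dots> \<le> (1 - \<eta>0) * (G k / (M * \<theta> k))"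
      using that(2) t M \<eta> by (simp add: field_simps power2_eq_square)
    also have "\<dots> \<le> (1 - \<eta>0) * predicted k"
      using M(2)[of k] that(2) \<eta> by (intro mult_left_mono) auto
    finally have "\<eta>0 * predicted k \<le> (norm (F (x k)))\<^sup>2 - (norm b)\<^sup>2"
      by (simp add: predicted_def a_def algebra_simps)
    then show ?thesis
      using predicted_pos[of k] unfolding k_def[symmetric]
      by (simp add: \<rho>_def reduction_ratio_def predicted_def b_def pos_le_divide_eq)
  qed
  then show ?thesis by (rule that)
qed

text \<open>
  Once \<open>\<theta>\<close> is large, the model gradient on a good iteration is within \<open>\<epsilon> / 2\<close> of the true one,
  so \<open>\<theta> G\<close> is large enough both for success and for \<open>\<theta>\<close> to be reduced.
\<close>
lemma good_step:
  assumes \<epsilon>: "0 < \<epsilon>"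
  obtains K c where "0 < c"
    "\<And>k. k \<ge> K \<Longrightarrow> good k \<Longrightarrow> \<epsilon> \<le> grad_norm k \<Longrightarrow>
       \<theta> (Suc k) = \<gamma>1 * \<theta> k \<and> c / \<theta> k \<le> sq_residual k - sq_residual (Suc k)"
proof -
  obtain M where M: "0 < M" "\<And>k. \<eta>1 \<le> \<theta> k * G k \<Longrightarrow> G k / (M * \<theta> k) \<le> predicted k"
    using predicted_ge_div by blast
  obtain E where E: "0 \<le> E" "\<And>k w. good (Suc k) \<Longrightarrow>
       norm ((J (Suc k) - jacobian F (at (x (Suc k)))) *v w) \<le> E / \<theta> (Suc k) * norm w"
    using model_error by blast
  obtain C where C: "\<And>k. good (Suc k) \<Longrightarrow> C \<le> \<theta> (Suc k) * G (Suc k) \<Longrightarrow> \<eta>0 \<le> \<rho> (Suc k)"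
    using success_of_good by blast
  define B where "B = max (max C (\<eta>2 + 1)) 1"
  \<comment> \<open>A bound on \<open>1 / \<theta>\<close> that makes the model gradient at least \<open>\<epsilon> / 2\<close>, makes
    \<open>\<theta> G\<close> at least \<open>B\<close>, and switches off the safeguard \<open>\<theta>min\<close>.\<close>
  define \<delta> where "\<delta> = Min {\<epsilon> / 2 / (E * norm (F x0) + 1), \<epsilon> / 2 / B, \<gamma>1 / \<theta>min}"
  have pos: "0 < E * norm (F x0) + 1" using E by (simp add: add_nonneg_pos)
  have "0 < \<delta>" using pos \<epsilon> \<gamma> \<theta>min by (simp add: \<delta>_def B_def)
  then obtain K where "\<forall>k\<ge>K. norm (1 / \<theta> k - 0) < \<delta>"
    using LIMSEQ_D[OF inverse_\<theta>_tendsto] by blast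
  then have K: "1 / \<theta> k < \<delta>" if "k \<ge> K" for k using that \<theta>_pos[of k] by auto
  \<comment> \<open>The shift by one skips the first iteration, whose sampling radius is not a step length.\<close>
  have "\<theta> (Suc k) = \<gamma>1 * \<theta> k \<and> \<eta>0 * \<epsilon> / (2 * M) / \<theta> k \<le> sq_residual k - sq_residual (Suc k)"
    if k: "k \<ge> Suc K" and good: "good k" and grad_norm: "\<epsilon> \<le> grad_norm k" for k
  proof -
    obtain j where j: "k = Suc j" using k by (cases k) auto
    have t: "0 < \<theta> k" by (rule \<theta>_pos)
    have t1: "1 / \<theta> k < \<epsilon> / 2 / (E * norm (F x0) + 1)" and t2: "1 / \<theta> k < \<epsilon> / 2 / B"
      and t3: "1 / \<theta> k < \<gamma>1 / \<theta>min" using K[of k] k by (auto simp: \<delta>_def)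
    let ?\<Delta> = "J k - jacobian F (at (x k))"
    have "norm (transpose ?\<Delta> *v F (x k)) \<le> E / \<theta> k * norm (F (x k))"
      by (rule norm_transpose_mult_vec_le) (use E(2)[of j] good j in auto)
    also have "\<dots> \<le> E / \<theta> k * norm (F x0)" using E t norm_F_le by (intro mult_left_mono) auto
    also have "\<dots> \<le> (E * norm (F x0) + 1) * (1 / \<theta> k)" using t by (simp add: field_simps)
    also have "\<dots> \<le> \<epsilon> / 2" using t1 pos t by (simp add: field_simps)
    finally have "norm (g k - objective_grad F (x k)) \<le> \<epsilon> / 2"
      by (simp add: g_def objective_grad_def transpose_diff matrix_vector_mult_diff_rdistrib
          del: transpose_matrix_vector)
    then have G: "\<epsilon> / 2 \<le> G k"
      using grad_norm norm_triangle_ineq2[of "objective_grad F (x k)" "g k"]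
      by (simp add: G_def grad_norm_def norm_minus_commute)
    have "B \<le> \<theta> k * (\<epsilon> / 2)" using t2 t by (simp add: B_def field_simps)
    also have "\<dots> \<le> \<theta> k * G k" using G t by (intro mult_left_mono) auto
    finally have \<theta>G: "C \<le> \<theta> k * G k" "\<eta>2 < \<theta> k * G k" "\<eta>1 \<le> \<theta> k * G k"
      using \<eta> by (auto simp: B_def)
    have succ: "\<eta>0 \<le> \<rho> k" using C[of j] good \<theta>G(1) j by simp
    have "\<theta>min \<le> \<gamma>1 * \<theta> k" using t3 t \<theta>min by (simp add: field_simps)
    then have "\<theta> (Suc k) = \<gamma>1 * \<theta> k"
      using succ \<theta>G t \<eta> by (auto simp: \<theta>_Suc theta_update_def field_simps)
    moreover have "\<eta>0 * \<epsilon> / (2 * M) / \<theta> k \<le> sq_residual k - sq_residual (Suc k)"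
    proof -
      have "\<eta>0 * \<epsilon> / (2 * M) / \<theta> k = \<eta>0 * ((\<epsilon> / 2) / (M * \<theta> k))" by simp
      also have "\<dots> \<le> \<eta>0 * (G k / (M * \<theta> k))"
        using G \<eta> M t by (intro mult_left_mono divide_right_mono) auto
      also have "\<dots> \<le> \<eta>0 * predicted k" using M(2)[OF \<theta>G(3)] \<eta> by (intro mult_left_mono) auto
      also have "\<dots> \<le> sq_residual k - sq_residual (Suc k)" by (rule success_decrease[OF succ])
      finally show ?thesis .
    qed
    ultimately show ?thesis by blast
  qed
  moreover have "0 < \<eta>0 * \<epsilon> / (2 * M)" using \<eta> \<epsilon> M by simp
  ultimately show ?thesis by (rule that[rotated])
qed

lemma good_steps_summable:
  assumes "0 < \<epsilon>"
  shows "summable (\<lambda>k. if good k \<and> \<epsilon> \<le> grad_norm k then 1 / \<theta> k else 0)"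
proof -
  obtain K c where c: "0 < c" and step: "\<And>k. k \<ge> K \<Longrightarrow> good k \<Longrightarrow> \<epsilon> \<le> grad_norm k \<Longrightarrow>
       \<theta> (Suc k) = \<gamma>1 * \<theta> k \<and> c / \<theta> k \<le> sq_residual k - sq_residual (Suc k)"
    using good_step[OF assms] by blast
  show ?thesis
  proof (rule summable_comparison_test)
    show "summable (\<lambda>k. (sq_residual k - sq_residual (Suc k)) / c)" by (intro summable_divide summable_sq_residual_diff)
    show "\<exists>N. \<forall>n\<ge>N. norm (if good n \<and> \<epsilon> \<le> grad_norm n then 1 / \<theta> n else 0) \<le> (sq_residual n - sq_residual (Suc n)) / c"
      using step c \<theta>_pos sq_residual_Suc_le
      by (intro exI[of _ K]) (auto simp: field_simps less_imp_le)
  qed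
qed

definition walk :: "nat \<Rightarrow> real" where
  "walk n = (\<Sum>k<n. if good k then - ln \<gamma>1 else - ln \<gamma>2)"

text \<open>
  If the gradient stayed at least \<open>\<epsilon>\<close>, then from some iteration on a step up of the walk would multiply \<open>\<theta>\<close> by
  \<open>\<gamma>1\<close>, and a step down multiplies it by at most \<open>\<gamma>2\<close>. So \<open>ln \<theta> + walk\<close> would not increase, and an unbounded walk
  would drive \<open>\<theta>\<close> below \<open>\<theta>min\<close>.
\<close>
lemma small_gradient_of_unbounded_walk:
  assumes unbounded: "\<And>c. \<exists>n. c < walk n" and \<epsilon>: "0 < \<epsilon>"
  shows "\<exists>k\<ge>N. grad_norm k < \<epsilon>"
proof (rule ccontr)
  assume "\<not> ?thesis"
  then have large: "\<epsilon> \<le> grad_norm k" if "k \<ge> N" for k using that by (meson not_le)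
  obtain K c where decr: "\<And>k. k \<ge> K \<Longrightarrow> good k \<Longrightarrow> \<epsilon> \<le> grad_norm k \<Longrightarrow>
       \<theta> (Suc k) = \<gamma>1 * \<theta> k \<and> c / \<theta> k \<le> sq_residual k - sq_residual (Suc k)"
    using good_step[OF \<epsilon>] by blast
  define m where "m = max K N"
  have le: "ln (\<theta> n) \<le> ln (\<theta> m) - (walk n - walk m)" if "n \<ge> m" for n
    using that
  proof (induction n rule: dec_induct)
    case (step n)
    have "ln (\<theta> (Suc n)) \<le> ln (\<theta> n) - (walk (Suc n) - walk n)"
    proof (cases "good n")
      case True
      then have "\<theta> (Suc n) = \<gamma>1 * \<theta> n" using step.hyps large[of n] decr[of n] by (auto simp: m_def)
      then show ?thesis using True \<gamma> \<theta>_pos[of n] by (simp add: walk_def ln_mult)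
    next
      case False
      have "ln (\<theta> (Suc n)) \<le> ln (\<gamma>2 * \<theta> n)" using \<theta>_Suc_le[of n] \<theta>_pos \<gamma> by (simp add: ln_le_cancel_iff)
      then show ?thesis using False \<gamma> \<theta>_pos[of n] by (simp add: walk_def ln_mult)
    qed
    then show ?case using step.IH by simp
  qed simp
  obtain n where n: "max (Max (walk ` {..m})) (ln (\<theta> m) - ln \<theta>min + walk m) < walk n"
    using unbounded by blast
  have "n \<ge> m"
  proof (rule ccontr)
    assume "\<not> n \<ge> m"
    then have "walk n \<le> Max (walk ` {..m})" by (intro Max_ge) auto
    moreover have "Max (walk ` {..m}) < walk n" using n by linarith
    ultimately show False by linarith
  qed
  moreover have "ln \<theta>min \<le> ln (\<theta> n)" using \<theta>min \<theta>_ge_min[of n] \<theta>_pos[of n] by simp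
  ultimately show False using le[of n] n by simp
qed

lemma objective_grad_lipschitz:
  obtains L where "0 < L" "\<And>a b. a \<in> level_set F x0 \<Longrightarrow> b \<in> level_set F x0 \<Longrightarrow>
    norm (objective_grad F a - objective_grad F b) \<le> L * norm (a - b)"
proof -
  obtain lf where lf: "0 < lf" "\<And>a b. a \<in> level_set F x0 \<Longrightarrow> b \<in> level_set F x0 \<Longrightarrow>
      norm (F a - F b) \<le> lf * norm (a - b)"
    using local.lf unfolding enlarged_level_set_def by blast
  have "bounded (level_set F x0)"
    using compact_imp_bounded[OF compact] bounded_subset unfolding enlarged_level_set_def by blast
  then obtain R where R: "0 < R" "\<And>a. a \<in> level_set F x0 \<Longrightarrow> norm a \<le> R"
    unfolding bounded_pos by blast
  define m where "m = real CARD('m)"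
  have Jd: "norm (transpose (jacobian F (at a) - jacobian F (at b)) *v w) \<le> (m * (\<kappa>lg * norm (a - b))) * norm w" for a b w
    by (rule norm_transpose_mult_vec_le, unfold m_def, rule norm_mult_vec_le_of_rows)
      (use lg(2) in \<open>simp add: row_eq_nth\<close>)
  obtain j0 where j0: "0 < j0" "\<And>w. norm (jacobian F (at 0) *v w) \<le> norm w * j0"
    using bounded_linear.pos_bounded[OF matrix_vector_mul_bounded_linear[of "jacobian F (at 0)"]] by blast
  have tj0: "norm (transpose (jacobian F (at 0)) *v w) \<le> j0 * norm w" for w
    by (rule norm_transpose_mult_vec_le) (use j0 in \<open>simp add: mult.commute\<close>)
  \<comment> \<open>A bound for the Jacobian on the level set, from its value at \<open>0\<close> and its Lipschitz constant.\<close>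
  define j where "j = m * (\<kappa>lg * R) + j0"
  have j: "0 < j" using lg R j0 by (simp add: j_def m_def add_nonneg_pos)
  have Jb: "norm (transpose (jacobian F (at a)) *v w) \<le> j * norm w" if "a \<in> level_set F x0" for a w
  proof -
    have "transpose (jacobian F (at a)) *v w
        = transpose (jacobian F (at a) - jacobian F (at 0)) *v w + transpose (jacobian F (at 0)) *v w"
      by (simp add: transpose_diff matrix_vector_mult_diff_rdistrib del: transpose_matrix_vector)
    then have "norm (transpose (jacobian F (at a)) *v w)
        \<le> norm (transpose (jacobian F (at a) - jacobian F (at 0)) *v w)
          + norm (transpose (jacobian F (at 0)) *v w)" by (metis norm_triangle_ineq)
    also have "\<dots> \<le> (m * (\<kappa>lg * norm (a - 0))) * norm w + j0 * norm w"
      by (intro add_mono Jd tj0)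
    also have "\<dots> \<le> (m * (\<kappa>lg * R)) * norm w + j0 * norm w"
      using R(2)[OF that] lg by (intro add_right_mono mult_right_mono mult_left_mono) (auto simp: m_def)
    finally show ?thesis by (simp add: j_def algebra_simps)
  qed
  define L where "L = m * \<kappa>lg * norm (F x0) + j * lf"
  have L: "0 < L" using lg j lf by (simp add: L_def m_def add_nonneg_pos)
  have "norm (objective_grad F a - objective_grad F b) \<le> L * norm (a - b)"
    if a: "a \<in> level_set F x0" and b: "b \<in> level_set F x0" for a b
  proof -
    have "objective_grad F a - objective_grad F b =
        transpose (jacobian F (at a) - jacobian F (at b)) *v F a + transpose (jacobian F (at b)) *v (F a - F b)"
      unfolding objective_grad_def
      by (simp add: transpose_diff matrix_vector_mult_diff_rdistrib matrix_vector_mult_diff_distrib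
          del: transpose_matrix_vector)
    then have "norm (objective_grad F a - objective_grad F b)
        \<le> norm (transpose (jacobian F (at a) - jacobian F (at b)) *v F a)
          + norm (transpose (jacobian F (at b)) *v (F a - F b))" by (metis norm_triangle_ineq)
    also have "\<dots> \<le> (m * (\<kappa>lg * norm (a - b))) * norm (F a) + j * norm (F a - F b)"
      by (intro add_mono Jd Jb b)
    also have "\<dots> \<le> (m * (\<kappa>lg * norm (a - b))) * norm (F x0) + j * (lf * norm (a - b))"
      using a lf(2)[OF a b] j lg by (intro add_mono mult_left_mono) (auto simp: m_def level_set_def)
    finally show ?thesis by (simp add: L_def algebra_simps)
  qed
  with L show ?thesis by (rule that)
qed

lemma norm_x_diff_le:
  assumes "j \<le> k"
  shows "norm (x k - x j) \<le> (\<Sum>i\<in>{j..<k}. 1 / \<theta> i)"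
  using assms
proof (induction k rule: dec_induct)
  case (step n)
  have "norm (x (Suc n) - x n) \<le> 1 / \<theta> n"
    using norm_d_le[of n] \<theta>_pos[of n] by (auto simp: x_Suc)
  moreover have "norm (x (Suc n) - x j) \<le> norm (x (Suc n) - x n) + norm (x n - x j)"
    using norm_triangle_ineq[of "x (Suc n) - x n" "x n - x j"] by simp
  ultimately show ?case using step by simp
qed simp

text \<open>
  The two assumptions are the facts that hold only with probability one; everything else about a
  realization is deterministic. In \<open>transfer\<close> the thresholds are the reciprocals \<open>1 / Suc N\<close>, so that
  countably many almost sure statements are enough.
\<close>
theorem gradient_tendsto_zero:
  assumes unbounded: "\<And>c. \<exists>n. c < walk n"
    and transfer: "\<And>N. summable (\<lambda>k. if good k \<and> 1 / real (Suc N) \<le> grad_norm k then 1 / \<theta> k else 0) \<Longrightarrow>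
      summable (\<lambda>k. if 1 / real (Suc N) \<le> grad_norm k then 1 / \<theta> k else 0)"
  shows "grad_norm \<longlonglongrightarrow> 0"
proof -
  obtain L where L: "0 < L" "\<And>a b. a \<in> level_set F x0 \<Longrightarrow> b \<in> level_set F x0 \<Longrightarrow>
    norm (objective_grad F a - objective_grad F b) \<le> L * norm (a - b)"
    using objective_grad_lipschitz by blast
  show ?thesis
  proof (rule tendsto_zero_of_summable_excursions[OF _ _ L(1) _ inverse_\<theta>_tendsto])
    show "0 \<le> grad_norm k" for k by (simp add: grad_norm_def)
    show "0 \<le> 1 / \<theta> k" for k using \<theta>_pos[of k] by simp
    show "\<bar>grad_norm k - grad_norm j\<bar> \<le> L * (\<Sum>i\<in>{j..<k}. 1 / \<theta> i)" if "j \<le> k" for j k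
    proof -
      have "\<bar>grad_norm k - grad_norm j\<bar> \<le> norm (objective_grad F (x k) - objective_grad F (x j))"
        unfolding grad_norm_def by (rule norm_triangle_ineq3)
      also have "\<dots> \<le> L * norm (x k - x j)" by (intro L x_in_level_set)
      also have "\<dots> \<le> L * (\<Sum>i\<in>{j..<k}. 1 / \<theta> i)"
        using norm_x_diff_le[OF that] L by (intro mult_left_mono) auto
      finally show ?thesis .
    qed
    show "\<exists>k\<ge>K. grad_norm k < \<epsilon>" if "0 < \<epsilon>" for \<epsilon> K
      by (rule small_gradient_of_unbounded_walk[OF unbounded that])
    show "summable (\<lambda>k. if \<epsilon> \<le> grad_norm k then 1 / \<theta> k else 0)" if pos: "0 < \<epsilon>" for \<epsilon>
    proof -
      obtain N where N: "1 / real (Suc N) < \<epsilon>" using nat_approx_posE[OF pos] by metis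
      have "summable (\<lambda>k. if 1 / real (Suc N) \<le> grad_norm k then 1 / \<theta> k else 0)"
        by (rule transfer[OF good_steps_summable]) simp
      then show ?thesis
        using N \<theta>_pos by (rule_tac summable_comparison_test[rotated]) (auto simp: less_imp_le)
    qed
  qed
qed

end


section \<open>Events with conditional probability bounded below\<close>

lemma (in prob_space) AE_summable_of_bounded_sum_expectation:
  fixes h :: "nat \<Rightarrow> 'a \<Rightarrow> real"
  assumes int: "\<And>k. integrable M (h k)" and nonneg: "\<And>k \<omega>. 0 \<le> h k \<omega>"
    and bound: "\<And>n. (\<Sum>k<n. expectation (h k)) \<le> C"
  shows "AE \<omega> in M. summable (\<lambda>k. h k \<omega>)"
proof -
  have [measurable]: "h k \<in> borel_measurable M" for k using int by blast
  have e0: "0 \<le> expectation (h k)" for k by (simp add: nonneg)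
  have "summable (\<lambda>k. expectation (h k))" by (rule summableI_nonneg_bounded[OF e0 bound])
  then have "(\<Sum>k. ennreal (expectation (h k))) = ennreal (\<Sum>k. expectation (h k))"
    by (rule suminf_ennreal2[OF e0])
  moreover have "(\<integral>\<^sup>+\<omega>. (\<Sum>k. ennreal (h k \<omega>)) \<partial>M) = (\<Sum>k. ennreal (expectation (h k)))"
    by (subst nn_integral_suminf) (auto simp: nn_integral_eq_integral int nonneg)
  ultimately have "AE \<omega> in M. (\<Sum>k. ennreal (h k \<omega>)) \<noteq> \<infinity>"
    by (intro nn_integral_PInf_AE) auto
  then show ?thesis
    by eventually_elim (auto intro: summable_suminf_not_top nonneg)
qed

text \<open>
  The past \<open>\<F> k\<close> does not see \<open>T k\<close>, which is decided between the stages \<open>k\<close> and \<open>Suc k\<close>.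
\<close>
locale likely_events = prob_space M for M :: "'w measure" +
  fixes \<F> :: "nat \<Rightarrow> 'w measure" and T :: "nat \<Rightarrow> 'w set" and \<beta> :: real
  assumes sub: "\<And>k. subalgebra M (\<F> k)"
    and mono: "\<And>k. sets (\<F> k) \<subseteq> sets (\<F> (Suc k))"
    and adapted: "\<And>k. T k \<in> sets (\<F> (Suc k))"
    and likely: "\<And>k. AE \<omega> in M. \<beta> \<le> real_cond_exp M (\<F> k) (indicator (T k)) \<omega>"
begin

lemma sets_T [measurable]: "T k \<in> sets M"
  using adapted sub unfolding subalgebra_def by blast

lemma measurable_M: "h \<in> borel_measurable (\<F> k) \<Longrightarrow> h \<in> borel_measurable M"
  using measurable_from_subalg sub by blast

lemma measurable_\<F>_mono:
  assumes "h \<in> borel_measurable (\<F> j)" "j \<le> k"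
  shows "h \<in> borel_measurable (\<F> k)"
proof -
  have "sets (\<F> j) \<subseteq> sets (\<F> k)" using lift_Suc_mono_le[of "\<lambda>k. sets (\<F> k)"] mono assms(2) by blast
  then have "subalgebra (\<F> k) (\<F> j)" using sub unfolding subalgebra_def by auto
  then show ?thesis using assms(1) measurable_from_subalg by blast
qed

lemma measurable_indicator_T: "j < k \<Longrightarrow> (indicator (T j) :: 'w \<Rightarrow> real) \<in> borel_measurable (\<F> k)"
  using measurable_\<F>_mono[of "indicator (T j)" "Suc j" k] adapted by auto

text \<open>
  The only form in which the conditional probability bound is used: it may be integrated against any
  bounded nonnegative function of the past.
\<close>
lemma expectation_indicator_T_ge:
  assumes meas: "h \<in> borel_measurable (\<F> k)" and nonneg: "\<And>\<omega>. 0 \<le> h \<omega>" and bound: "\<And>\<omega>. h \<omega> \<le> B"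
  shows "integrable M (\<lambda>\<omega>. h \<omega> * indicator (T k) \<omega>)"
    and "integrable M h"
    and "\<beta> * expectation h \<le> expectation (\<lambda>\<omega>. h \<omega> * indicator (T k) \<omega>)"
proof -
  interpret finite_measure_subalgebra M "\<F> k" by unfold_locales (rule sub)
  have [measurable]: "h \<in> borel_measurable M" by (rule measurable_M[OF meas])
  have B: "0 \<le> B" using nonneg bound order_trans by blast
  show i1: "integrable M (\<lambda>\<omega>. h \<omega> * indicator (T k) \<omega>)"
    by (rule integrable_const_bound[where B = B]) (auto simp: nonneg bound B indicator_def)
  show i2: "integrable M h"
    by (rule integrable_const_bound[where B = B]) (auto simp: nonneg bound)
  have m: "(indicator (T k) :: 'w \<Rightarrow> real) \<in> borel_measurable M" by simp
  have "\<beta> * expectation h = (\<integral>\<omega>. h \<omega> * \<beta> \<partial>M)" by (simp add: mult.commute)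
  also have "\<dots> \<le> (\<integral>\<omega>. h \<omega> * real_cond_exp M (\<F> k) (indicator (T k)) \<omega> \<partial>M)"
  proof (rule integral_mono_AE)
    show "integrable M (\<lambda>\<omega>. h \<omega> * \<beta>)" using i2 by simp
    show "integrable M (\<lambda>\<omega>. h \<omega> * real_cond_exp M (\<F> k) (indicator (T k)) \<omega>)"
      by (rule real_cond_exp_intg(1)[OF i1 meas m])
    show "AE \<omega> in M. h \<omega> * \<beta> \<le> h \<omega> * real_cond_exp M (\<F> k) (indicator (T k)) \<omega>"
      using likely[of k] by eventually_elim (intro mult_left_mono nonneg)
  qed
  also have "\<dots> = expectation (\<lambda>\<omega>. h \<omega> * indicator (T k) \<omega>)"
    by (rule real_cond_exp_intg(2)[OF i1 meas m])
  finally show "\<beta> * expectation h \<le> expectation (\<lambda>\<omega>. h \<omega> * indicator (T k) \<omega>)" .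
qed

text \<open>
  A conditional Borel--Cantelli lemma. Truncate by keeping the terms \<open>h k\<close> only while the sum over the
  events has not exceeded \<open>c\<close>. Whether it has is known from the past, so the expected
  sum of the kept terms is at most \<open>1 / \<beta>\<close> times the expected sum of those kept on the events, and the latter
  sum never exceeds \<open>c + B\<close>. Hence the kept terms are almost surely summable, and where the
  sum over the events is finite, all terms are kept for some \<open>c\<close>.
\<close>
lemma summable_of_summable_on_T:
  fixes h :: "nat \<Rightarrow> 'w \<Rightarrow> real"
  assumes \<beta>: "0 < \<beta>" and meas: "\<And>k. h k \<in> borel_measurable (\<F> k)"
    and nonneg: "\<And>k \<omega>. 0 \<le> h k \<omega>" and bound: "\<And>k \<omega>. h k \<omega> \<le> B"
  shows "AE \<omega> in M. summable (\<lambda>k. h k \<omega> * indicator (T k) \<omega>) \<longrightarrow> summable (\<lambda>k. h k \<omega>)"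
proof -
  define S where "S n \<omega> = (\<Sum>k<n. h k \<omega> * indicator (T k) \<omega>)" for n \<omega>
  have S_meas: "S n \<in> borel_measurable (\<F> n)" for n
  proof -
    have "(\<lambda>\<omega>. h k \<omega> * indicator (T k) \<omega>) \<in> borel_measurable (\<F> n)" if "k < n" for k
      using measurable_\<F>_mono[OF meas, of k n] measurable_indicator_T[OF that] that
      by (intro borel_measurable_times) auto
    then show ?thesis unfolding S_def by (intro borel_measurable_sum) auto
  qed
  have B: "0 \<le> B" using nonneg bound order_trans by blast
  have "AE \<omega> in M. summable (\<lambda>k. if S k \<omega> \<le> real c then h k \<omega> else 0)" for c :: nat
  proof (rule AE_summable_of_bounded_sum_expectation)
    define H where "H k \<omega> = (if S k \<omega> \<le> real c then h k \<omega> else 0)" for k \<omega>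
    have H: "H k \<in> borel_measurable (\<F> k)" "0 \<le> H k \<omega>" "H k \<omega> \<le> B" for k \<omega>
      unfolding H_def using S_meas[of k] meas[of k] nonneg bound B by (measurable, auto)
    note E = expectation_indicator_T_ge[OF H]
    show "integrable M (\<lambda>\<omega>. if S k \<omega> \<le> real c then h k \<omega> else 0)" for k
      using E(2)[of k] unfolding H_def .
    show "0 \<le> (if S k \<omega> \<le> real c then h k \<omega> else 0)" for k \<omega> by (simp add: nonneg)
    show "(\<Sum>k<n. expectation (\<lambda>\<omega>. if S k \<omega> \<le> real c then h k \<omega> else 0)) \<le> (c + B) / \<beta>" for n
    proof -
      have pt: "(\<Sum>k<n. H k \<omega> * indicator (T k) \<omega>) \<le> c + B" for \<omega>
      proof (induction n)
        case (Suc n)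
        show ?case
        proof (cases "S n \<omega> \<le> c")
          case True
          have "(\<Sum>k<n. H k \<omega> * indicator (T k) \<omega>) \<le> S n \<omega>"
            unfolding S_def H_def by (intro sum_mono) (simp add: nonneg)
          moreover have "H n \<omega> * indicator (T n) \<omega> \<le> B" using H(2,3)[of n \<omega>] B by (simp add: indicator_def)
          ultimately show ?thesis using True by simp
        next
          case False
          then show ?thesis using Suc by (simp add: H_def)
        qed
      qed (use B in simp)
      have "\<beta> * (\<Sum>k<n. expectation (H k)) \<le> (\<Sum>k<n. expectation (\<lambda>\<omega>. H k \<omega> * indicator (T k) \<omega>))"
        unfolding sum_distrib_left by (intro sum_mono E)
      also have "\<dots> = expectation (\<lambda>\<omega>. \<Sum>k<n. H k \<omega> * indicator (T k) \<omega>)"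
        by (rule Bochner_Integration.integral_sum[symmetric]) (rule E)
      also have "\<dots> \<le> expectation (\<lambda>\<omega>. c + B)"
        by (intro integral_mono pt Bochner_Integration.integrable_sum E) auto
      finally have "\<beta> * (\<Sum>k<n. expectation (H k)) \<le> c + B" by (simp add: prob_space)
      then show ?thesis using \<beta> unfolding H_def by (simp add: pos_le_divide_eq mult.commute)
    qed
  qed
  then have "AE \<omega> in M. \<forall>c::nat. summable (\<lambda>k. if S k \<omega> \<le> real c then h k \<omega> else 0)"
    by (simp add: AE_all_countable)
  then show ?thesis
  proof eventually_elim
    case (elim \<omega>)
    show ?case
    proof
      assume s: "summable (\<lambda>k. h k \<omega> * indicator (T k) \<omega>)"
      obtain c :: nat where c: "(\<Sum>k. h k \<omega> * indicator (T k) \<omega>) \<le> c" using real_arch_simple by blast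
      have "S k \<omega> \<le> c" for k
        using sum_le_suminf[OF s, of "{..<k}"] c nonneg unfolding S_def by auto
      then show "summable (\<lambda>k. h k \<omega>)" using elim[rule_format, of c] by simp
    qed
  qed
qed

text \<open>
  The drift may be exactly zero, so a law of large numbers is not enough. Stop the walk when it first
  exceeds \<open>c\<close>. The stopped walk \<open>Y\<close> has nonnegative mean and is at most \<open>c + a\<close>. By strict convexity
  of the exponential, \<open>exp W\<close> has conditional growth factor at least \<open>1 + q\<close> with \<open>q > 0\<close> before stopping, and
  since it is bounded there, it is summable along almost every path that is never stopped. On such a path the
  walk tends to \<open>- \<infinity>\<close>. By Fatou's lemma the nonnegative variables \<open>c + a - Y\<close>, whose
  means are at most \<open>c + a\<close>, cannot tend to infinity with positive probability, so almost
  every path is stopped.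
\<close>
lemma walk_unbounded:
  assumes ab: "0 < a" "0 < b" and drift: "(1 - \<beta>) * b \<le> \<beta> * a" and \<beta>: "0 < \<beta>" "\<beta> < 1"
  shows "AE \<omega> in M. \<forall>c. \<exists>n. c < (\<Sum>k<n. if \<omega> \<in> T k then a else - b)"
proof -
  define \<Delta> where "\<Delta> k \<omega> = (a + b) * indicator (T k) \<omega> - b" for k \<omega>
  define W where "W n \<omega> = (\<Sum>k<n. \<Delta> k \<omega>)" for n \<omega>
  have W_eq: "W n \<omega> = (\<Sum>k<n. if \<omega> \<in> T k then a else - b)" for n \<omega>
    unfolding W_def \<Delta>_def by (intro sum.cong) auto
  have \<Delta>_le: "\<Delta> k \<omega> \<le> a" for k \<omega> using ab by (auto simp: \<Delta>_def indicator_def)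
  have \<Delta>_meas: "\<Delta> j \<in> borel_measurable (\<F> k)" if "j < k" for j k
    unfolding \<Delta>_def using measurable_indicator_T[OF that] by measurable
  have W_meas: "W n \<in> borel_measurable (\<F> n)" for n
    unfolding W_def by (intro borel_measurable_sum \<Delta>_meas) auto
  have "AE \<omega> in M. \<exists>n. real c < W n \<omega>" for c :: nat
  proof -
    \<comment> \<open>\<open>I n\<close> indicates that the walk has not exceeded \<open>c\<close> up to time \<open>n\<close>, and \<open>Y\<close> is the stopped walk.\<close>
    define I :: "nat \<Rightarrow> 'w \<Rightarrow> real" where "I n \<omega> = (if \<forall>j\<in>{..n}. W j \<omega> \<le> c then 1 else 0)" for n \<omega>
    define Y where "Y n \<omega> = (\<Sum>k<n. I k \<omega> * \<Delta> k \<omega>)" for n \<omega>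
    define Z where "Z k \<omega> = I k \<omega> * exp (W k \<omega>)" for k \<omega>
    have W_meas': "W j \<in> borel_measurable (\<F> n)" if "j \<in> {..n}" for j n
      using measurable_\<F>_mono[OF W_meas] that by auto
    have I_meas: "I n \<in> borel_measurable (\<F> n)" for n
      unfolding I_def using W_meas' by measurable
    have I01: "0 \<le> I n \<omega>" "I n \<omega> \<le> 1" for n \<omega> by (auto simp: I_def)
    have Z: "Z n \<in> borel_measurable (\<F> n)" "0 \<le> Z n \<omega>" "Z n \<omega> \<le> exp c" for n \<omega>
      unfolding Z_def using I_meas[of n] W_meas[of n] by (measurable, auto simp: I_def)
    note EI = expectation_indicator_T_ge[OF I_meas I01]
    note EZ = expectation_indicator_T_ge[OF Z]
    have stopped: "Y n \<omega> \<le> c + a \<and> (I n \<omega> = 1 \<longrightarrow> Y n \<omega> = W n \<omega>) \<and>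
        (\<Sum>k<n. I k \<omega> * (exp (W (Suc k) \<omega>) - exp (W k \<omega>))) = exp (Y n \<omega>) - 1" for n \<omega>
    proof (induction n)
      case 0
      then show ?case using ab by (simp add: Y_def W_def)
    next
      case (Suc n)
      show ?case
      proof (cases "I n \<omega> = 1")
        case True
        then have "W n \<omega> \<le> c" by (auto simp: I_def split: if_splits)
        moreover have "Y (Suc n) \<omega> = Y n \<omega> + \<Delta> n \<omega>" using True by (simp add: Y_def)
        moreover have "W (Suc n) \<omega> = W n \<omega> + \<Delta> n \<omega>" by (simp add: W_def)
        ultimately show ?thesis using Suc True \<Delta>_le[of n \<omega>] by auto
      next
        case False
        then have "I n \<omega> = 0" by (simp add: I_def split: if_splits)
        moreover have "I (Suc n) \<omega> = 0" using False by (auto simp: I_def split: if_splits)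
        ultimately show ?thesis using Suc by (simp add: Y_def)
      qed
    qed
    have Y_int: "integrable M (Y n)" for n
    proof -
      have "integrable M (\<lambda>\<omega>. \<Sum>k<n. (a + b) * (I k \<omega> * indicator (T k) \<omega>) - b * I k \<omega>)"
        by (intro Bochner_Integration.integrable_sum Bochner_Integration.integrable_diff integrable_mult_right EI)
      then show ?thesis unfolding Y_def \<Delta>_def by (simp add: algebra_simps)
    qed
    have Y_mean: "0 \<le> expectation (Y n)" for n
    proof -
      have "0 \<le> (\<Sum>k<n. ((a + b) * \<beta> - b) * expectation (I k))"
        using drift I01 by (intro sum_nonneg mult_nonneg_nonneg integral_nonneg) (auto simp: algebra_simps)
      also have "\<dots> \<le> (\<Sum>k<n. (a + b) * expectation (\<lambda>\<omega>. I k \<omega> * indicator (T k) \<omega>) - b * expectation (I k))"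
        using mult_left_mono[OF EI(3), of "a + b"] ab by (intro sum_mono) (simp add: algebra_simps)
      also have "\<dots> = (\<Sum>k<n. expectation (\<lambda>\<omega>. (a + b) * (I k \<omega> * indicator (T k) \<omega>) - b * I k \<omega>))"
        using EI by simp
      also have "\<dots> = expectation (\<lambda>\<omega>. \<Sum>k<n. (a + b) * (I k \<omega> * indicator (T k) \<omega>) - b * I k \<omega>)"
        by (rule Bochner_Integration.integral_sum[symmetric])
          (intro Bochner_Integration.integrable_diff integrable_mult_right EI)
      also have "\<dots> = expectation (Y n)"
        unfolding Y_def \<Delta>_def by (simp add: algebra_simps)
      finally show ?thesis .
    qed
    define q where "q = \<beta> * exp a + (1 - \<beta>) * exp (- b) - 1"
    have q: "0 < q"
    proof -
      have "1 + a + a\<^sup>2 / 2 \<le> exp a" using ab by (intro exp_lower_Taylor_quadratic) auto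
      then have "1 + a < exp a" using ab by (smt (verit) divide_pos_pos zero_less_power)
      then have "\<beta> * (1 + a) < \<beta> * exp a" using \<beta> by simp
      moreover have "(1 - \<beta>) * (1 + (- b)) \<le> (1 - \<beta>) * exp (- b)"
        using \<beta> exp_ge_add_one_self[of "- b"] by (intro mult_left_mono) auto
      ultimately show ?thesis using drift by (simp add: q_def algebra_simps)
    qed
    have "AE \<omega> in M. summable (\<lambda>k. Z k \<omega>)"
    proof (rule AE_summable_of_bounded_sum_expectation[OF EZ(2) Z(2)])
      fix n
      have incr: "I k \<omega> * (exp (W (Suc k) \<omega>) - exp (W k \<omega>)) =
          (exp a - exp (- b)) * (Z k \<omega> * indicator (T k) \<omega>) - (1 - exp (- b)) * Z k \<omega>" for k \<omega>
      proof -
        have "exp (W (Suc k) \<omega>) = exp (W k \<omega>) * exp (\<Delta> k \<omega>)" by (simp add: W_def exp_add)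
        moreover have "exp (\<Delta> k \<omega>) = (exp a - exp (- b)) * indicator (T k) \<omega> + exp (- b)"
          by (cases "\<omega> \<in> T k") (simp_all add: \<Delta>_def)
        ultimately show ?thesis by (simp only: Z_def) (simp add: algebra_simps)
      qed
      have "q * (\<Sum>k<n. expectation (Z k)) = (\<Sum>k<n. (exp a - exp (- b)) * (\<beta> * expectation (Z k)) - (1 - exp (- b)) * expectation (Z k))"
        unfolding sum_distrib_left by (intro sum.cong) (auto simp: q_def algebra_simps)
      also have "\<dots> \<le> (\<Sum>k<n. (exp a - exp (- b)) * expectation (\<lambda>\<omega>. Z k \<omega> * indicator (T k) \<omega>) - (1 - exp (- b)) * expectation (Z k))"
        using ab by (intro sum_mono diff_right_mono mult_left_mono EZ(3)) auto
      also have "\<dots> = (\<Sum>k<n. expectation (\<lambda>\<omega>. I k \<omega> * (exp (W (Suc k) \<omega>) - exp (W k \<omega>))))"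
        unfolding incr using EZ by simp
      also have "\<dots> = expectation (\<lambda>\<omega>. \<Sum>k<n. I k \<omega> * (exp (W (Suc k) \<omega>) - exp (W k \<omega>)))"
        unfolding incr by (rule Bochner_Integration.integral_sum[symmetric])
          (intro Bochner_Integration.integrable_diff integrable_mult_right EZ)
      also have "\<dots> \<le> expectation (\<lambda>\<omega>. exp (c + a))"
      proof (rule integral_mono)
        show "integrable M (\<lambda>\<omega>. \<Sum>k<n. I k \<omega> * (exp (W (Suc k) \<omega>) - exp (W k \<omega>)))"
          unfolding incr by (intro Bochner_Integration.integrable_sum Bochner_Integration.integrable_diff integrable_mult_right EZ)
        show "(\<Sum>k<n. I k \<omega> * (exp (W (Suc k) \<omega>) - exp (W k \<omega>))) \<le> exp (c + a)" for \<omega>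
        proof -
          have "exp (Y n \<omega>) \<le> exp (c + a)" using stopped[of n \<omega>] by simp
          moreover have "exp (Y n \<omega>) - 1 \<le> exp (Y n \<omega>)" by simp
          ultimately show ?thesis using stopped[of n \<omega>] by linarith
        qed
      qed simp
      finally have "q * (\<Sum>k<n. expectation (Z k)) \<le> exp (c + a)" by (simp add: prob_space)
      then show "(\<Sum>k<n. expectation (Z k)) \<le> exp (c + a) / q"
        using q by (simp add: pos_le_divide_eq mult.commute)
    qed
    moreover have "AE \<omega> in M. liminf (\<lambda>n. ennreal (c + a - Y n \<omega>)) \<noteq> \<infinity>"
    proof (rule nn_integral_PInf_AE)
      have [measurable]: "Y n \<in> borel_measurable M" for n using Y_int by blast
      show "(\<lambda>\<omega>. liminf (\<lambda>n. ennreal (c + a - Y n \<omega>))) \<in> borel_measurable M" by measurable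
      have "(\<integral>\<^sup>+\<omega>. ennreal (c + a - Y n \<omega>) \<partial>M) \<le> ennreal (c + a)" for n
      proof -
        have "(\<integral>\<^sup>+\<omega>. ennreal (c + a - Y n \<omega>) \<partial>M) = ennreal (expectation (\<lambda>\<omega>. c + a - Y n \<omega>))"
          using stopped Y_int by (intro nn_integral_eq_integral) auto
        also have "expectation (\<lambda>\<omega>. c + a - Y n \<omega>) = c + a - expectation (Y n)"
          using Y_int by (simp add: prob_space)
        also have "ennreal \<dots> \<le> ennreal (c + a)" using Y_mean[of n] by (intro ennreal_leI) simp
        finally show ?thesis .
      qed
      then have "liminf (\<lambda>n. \<integral>\<^sup>+\<omega>. ennreal (c + a - Y n \<omega>) \<partial>M) \<le> liminf (\<lambda>n. ennreal (c + a))"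
        by (intro Liminf_mono always_eventually) auto
      then have "(\<integral>\<^sup>+\<omega>. liminf (\<lambda>n. ennreal (c + a - Y n \<omega>)) \<partial>M) \<le> ennreal (c + a)"
        by (intro order_trans[OF nn_integral_liminf]) (auto simp: Liminf_const)
      then show "(\<integral>\<^sup>+\<omega>. liminf (\<lambda>n. ennreal (c + a - Y n \<omega>)) \<partial>M) \<noteq> \<infinity>"
        by (auto simp: top_unique)
    qed
    ultimately show ?thesis
    proof eventually_elim
      case (elim \<omega>)
      show ?case
      proof (rule ccontr)
        assume "\<not> ?thesis"
        then have le: "W n \<omega> \<le> c" for n by (meson not_le)
        then have I1: "I n \<omega> = 1" for n by (simp add: I_def)
        have "(\<lambda>n. exp (W n \<omega>)) \<longlonglongrightarrow> 0"
          using summable_LIMSEQ_zero[OF elim(1)] by (simp add: Z_def I1)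
        have "of_nat K \<le> liminf (\<lambda>n. ennreal (c + a - Y n \<omega>))" for K :: nat
        proof (rule Liminf_bounded)
          have "\<forall>\<^sub>F n in sequentially. exp (W n \<omega>) < exp (c + a - K)"
            by (rule order_tendstoD(2)[OF \<open>(\<lambda>n. exp (W n \<omega>)) \<longlonglongrightarrow> 0\<close>]) simp
          then show "\<forall>\<^sub>F n in sequentially. of_nat K \<le> ennreal (c + a - Y n \<omega>)"
          proof eventually_elim
            case (elim n)
            then have "real K \<le> c + a - Y n \<omega>" using stopped[of n \<omega>] I1[of n] by simp
            then show ?case by (simp add: ennreal_of_nat_eq_real_of_nat ennreal_leI)
          qed
        qed
        moreover obtain K :: nat where "liminf (\<lambda>n. ennreal (c + a - Y n \<omega>)) < of_nat K"
          using elim(2) ennreal_Ex_less_of_nat by (auto simp: top.not_eq_extremum)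
        ultimately show False by (meson not_le)
      qed
    qed
  qed
  then have "AE \<omega> in M. \<forall>c::nat. \<exists>n. real c < W n \<omega>" by (simp add: AE_all_countable)
  then show ?thesis
  proof eventually_elim
    case (elim \<omega>)
    show ?case
    proof
      fix c :: real
      obtain m :: nat where "c \<le> m" using real_arch_simple by blast
      then show "\<exists>n. c < (\<Sum>k<n. if \<omega> \<in> T k then a else - b)"
        using elim[rule_format, of m] unfolding W_eq by (meson le_less_trans)
    qed
  qed
qed

end


section \<open>Measurability and almost sure convergence\<close>

lemma closed_rip_bound: "closed {A :: real^'n^'p. rip_bound q A \<delta>}"
proof -
  have cont: "continuous_on UNIV (\<lambda>A :: real^'n^'p. A *v x)" for x
    by (intro linear_continuous_on linear_conv_bounded_linear[THEN iffD1] linearI)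
      (simp_all add: matrix_vector_mult_add_rdistrib scaleR_matrix_vector_assoc)
  have "{A :: real^'n^'p. rip_bound q A \<delta>} = (\<Inter>x\<in>{x. sparse_vec q x}.
      {A. (1 - \<delta>) * (norm x)\<^sup>2 \<le> (norm (A *v x))\<^sup>2} \<inter> {A. (norm (A *v x))\<^sup>2 \<le> (1 + \<delta>) * (norm x)\<^sup>2})"
    by (auto simp: rip_bound_def)
  also have "closed \<dots>"
    by (intro closed_INT ballI closed_Int closed_Collect_le continuous_intros cont)
  finally show ?thesis .
qed

text \<open>
  Being an RIP matrix is a strict bound on a minimum, hence a countable union, over rational bounds, of closed
  conditions.
\<close>
lemma borel_bounded_RIP:
  assumes "1 \<le> s"
  shows "{A :: real^'n^'p. RIP_matrix s A \<and> (\<forall>j. norm (A $ j) \<le> \<kappa>)} \<in> sets borel"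
proof -
  have mono: "rip_bound q A \<delta>'" if "rip_bound q A \<delta>" "\<delta> \<le> \<delta>'" for q \<delta> \<delta>' and A :: "real^'n^'p"
    using that unfolding rip_bound_def by (smt (verit) mult_right_mono zero_le_power2)
  have "RIP_matrix s A \<longleftrightarrow> (\<exists>\<delta>\<in>\<rat>. \<delta> < 0.4931 \<and> rip_bound (2 * s) A \<delta>)" for A :: "real^'n^'p"
  proof
    assume "RIP_matrix s A"
    then obtain \<delta> where \<delta>: "\<delta> \<in> \<rat>" "rip_constant (2 * s) A < \<delta>" "\<delta> < 0.4931"
      unfolding RIP_matrix_def using Rats_dense_in_real by blast
    moreover have "rip_bound (2 * s) A (rip_constant (2 * s) A)"
      using assms by (intro rip_constant_least) simp
    ultimately show "\<exists>\<delta>\<in>\<rat>. \<delta> < 0.4931 \<and> rip_bound (2 * s) A \<delta>"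
      using mono less_imp_le by blast
  next
    assume "\<exists>\<delta>\<in>\<rat>. \<delta> < 0.4931 \<and> rip_bound (2 * s) A \<delta>"
    then obtain \<delta> where "\<delta> < 0.4931" "rip_bound (2 * s) A \<delta>" by blast
    then show "RIP_matrix s A"
      using rip_constant_least(2)[of "2 * s" A \<delta>] assms by (simp add: RIP_matrix_def)
  qed
  then have "{A :: real^'n^'p. RIP_matrix s A \<and> (\<forall>j. norm (A $ j) \<le> \<kappa>)} =
      (\<Union>\<delta>\<in>\<rat> \<inter> {..<0.4931}. {A. rip_bound (2 * s) A \<delta>}) \<inter> (\<Inter>j. {A. norm (A $ j) \<le> \<kappa>})"
    by auto
  also have "\<dots> \<in> sets borel"
  proof (intro sets.Int sets.countable_UN'' borel_closed closed_rip_bound)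
    show "countable (\<rat> \<inter> {..<0.4931 :: real})" using countable_rat by blast
    show "closed (\<Inter>j. {A :: real^'n^'p. norm (A $ j) \<le> \<kappa>})"
      by (intro closed_INT ballI closed_Collect_le continuous_intros)
  qed
  finally show ?thesis .
qed

lemma continuous_objective_grad:
  fixes F :: "real^'n \<Rightarrow> real^'m"
  assumes "C1_map F"
  shows "continuous_on UNIV (objective_grad F)"
proof -
  have J: "continuous_on UNIV (\<lambda>x. jacobian F (at x))" using assms by (simp add: C1_map_def)
  have F: "continuous_on UNIV F"
    by (rule differentiable_imp_continuous_on) (use assms in \<open>simp add: C1_map_def differentiable_on_def\<close>)
  have "objective_grad F = (\<lambda>y. \<chi> j. \<Sum>i\<in>UNIV. jacobian F (at y) $ i $ j * F y $ i)"
    by (rule ext) (simp add: objective_grad_def vector_matrix_mult_def vec_eq_iff mult.commute)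
  moreover have "continuous_on UNIV \<dots>"
    by (intro continuous_on_vec_lambda continuous_on_sum continuous_on_mult continuous_on_component J F)
  ultimately show ?thesis by simp
qed

lemma sets_past:
  "sets (past M V k) = sigma_sets (space M) (\<Union>j<k. {V j -` B \<inter> space M | B. B \<in> sets borel})"
  unfolding past_def by (rule sets_measure_of) auto

lemma subalgebra_past:
  assumes "\<And>k. V k \<in> borel_measurable M"
  shows "subalgebra M (past M V k)"
  unfolding subalgebra_def
proof
  have "(\<Union>j<k. {V j -` B \<inter> space M | B. B \<in> sets borel}) \<subseteq> sets M"
    using measurable_sets[OF assms] by blast
  then show "sets (past M V k) \<subseteq> sets M" unfolding sets_past by (rule sets.sigma_sets_subset)
  show "space (past M V k) = space M" unfolding past_def by (rule space_measure_of) auto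
qed

lemma past_mono: "j \<le> k \<Longrightarrow> sets (past M V j) \<subseteq> sets (past M V k)"
  unfolding sets_past by (intro sigma_sets_subseteq UN_mono) auto

lemma vimage_in_past: "j < k \<Longrightarrow> B \<in> sets borel \<Longrightarrow> V j -` B \<inter> space M \<in> sets (past M V k)"
  unfolding sets_past by (rule sigma_sets.Basic) blast

lemma likely_events_bounded_RIP:
  fixes V :: "nat \<Rightarrow> 'w \<Rightarrow> real^'n^'p"
  assumes "prob_space M" "1 \<le> s" and V: "\<And>k. V k \<in> borel_measurable M"
    and RIP: "prob_bounded_RIP M s \<beta> \<kappa> V"
  shows "likely_events M (past M V) (\<lambda>k. bounded_RIP_event M s \<kappa> (V k)) \<beta>"
proof -
  interpret prob_space M by fact
  show ?thesis
  proof
    show "subalgebra M (past M V k)" for k by (rule subalgebra_past[OF V])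
    show "sets (past M V k) \<subseteq> sets (past M V (Suc k))" for k by (rule past_mono) simp
    have eq: "bounded_RIP_event M s \<kappa> (V k) =
        V k -` {A. RIP_matrix s A \<and> (\<forall>j. norm (A $ j) \<le> \<kappa>)} \<inter> space M" for k
      by (auto simp: bounded_RIP_event_def)
    show "bounded_RIP_event M s \<kappa> (V k) \<in> sets (past M V (Suc k))" for k
      unfolding eq by (rule vimage_in_past[OF lessI borel_bounded_RIP[OF \<open>1 \<le> s\<close>]])
    show "AE \<omega> in M. \<beta> \<le> real_cond_exp M (past M V k) (indicator (bounded_RIP_event M s \<kappa> (V k))) \<omega>" for k
      using RIP by (simp add: prob_bounded_RIP_def)
  qed
qed

theorem theorem4p8:
  fixes F :: "real^'n \<Rightarrow> real^'m"
    and x0 :: "real^'n"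
    and \<eta>0 \<eta>1 \<eta>2 \<gamma>1 \<gamma>2 \<theta>0 \<theta>min \<sigma>0 \<kappa>lg \<kappa>bv \<beta> :: real
    and s :: nat
    and M :: "'w measure"
    and V :: "nat \<Rightarrow> 'w \<Rightarrow> real^'n^'p"
    and X D :: "nat \<Rightarrow> 'w \<Rightarrow> real^'n"
    and \<Theta> \<Sigma> \<Xi> :: "nat \<Rightarrow> 'w \<Rightarrow> real"
    and Jm :: "nat \<Rightarrow> 'w \<Rightarrow> real^'n^'m"
  assumes "CARD('p) < CARD('n)" and "s \<ge> 1"
    and "0 < \<eta>0" "\<eta>0 < 1" "0 < \<eta>1" "\<eta>1 < \<eta>2"
    and "0 < \<gamma>1" "\<gamma>1 < 1" "1 < \<gamma>2"
    and "0 < \<theta>min" "\<theta>min \<le> \<theta>0" "0 < \<sigma>0"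
    and A1_C1: "C1_map F"
    and A1_lipschitz: "\<kappa>lg > 0"
      "\<And>i x y. norm (row i (jacobian F (at x)) - row i (jacobian F (at y))) \<le> \<kappa>lg * norm (x - y)"
    and A1_sparse: "\<And>i x. sparse_vec s (row i (jacobian F (at x)))"
    and A2_compact: "compact (enlarged_level_set F x0 \<theta>min)"
    and A2_lipschitz: "\<exists>\<kappa>lf>0. \<forall>x\<in>enlarged_level_set F x0 \<theta>min. \<forall>y\<in>enlarged_level_set F x0 \<theta>min.
      norm (F y - F x) \<le> \<kappa>lf * norm (y - x)"
    and prob: "prob_space M"
    and V_random: "\<And>k. V k \<in> borel_measurable M"
    and X_adapted: "\<And>k. X k \<in> borel_measurable (past M V k)"
    and \<Theta>_adapted: "\<And>k. \<Theta> k \<in> borel_measurable (past M V k)"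
    and algorithm: "\<And>\<omega>. \<omega> \<in> space M \<Longrightarrow>
      lm_realization F \<eta>0 \<eta>1 \<eta>2 \<gamma>1 \<gamma>2 \<theta>min x0 \<theta>0
        (\<lambda>k. \<Sigma> k \<omega>) (\<lambda>k. \<Xi> k \<omega>) (\<lambda>k. V k \<omega>)
        (\<lambda>k. X k \<omega>) (\<lambda>k. \<Theta> k \<omega>) (\<lambda>k. Jm k \<omega>) (\<lambda>k. D k \<omega>)"
    and sigma: "\<And>\<omega>. \<omega> \<in> space M \<Longrightarrow> \<Sigma> 0 \<omega> = \<sigma>0"
      "\<And>k \<omega>. \<omega> \<in> space M \<Longrightarrow> \<Sigma> (Suc k) \<omega> = norm (D k \<omega>)"
    and xi: "\<And>k \<omega>. \<omega> \<in> space M \<Longrightarrow>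
      \<Xi> k \<omega> = sqrt (real CARD('p)) * \<kappa>lg * \<kappa>bv\<^sup>2 * \<Sigma> k \<omega> / 2"
    and A3: "\<And>\<omega>. \<omega> \<in> space M \<Longrightarrow> \<exists>\<kappa>bmj>0. \<forall>k. spectral_norm (Jm k \<omega>) \<le> \<kappa>bmj"
    and beta: "0 < \<beta>" "\<beta> < 1" "\<beta> \<ge> ln \<gamma>2 / (ln \<gamma>2 - ln \<gamma>1)"
    and "\<kappa>bv > 0"
    and RIP: "prob_bounded_RIP M s \<beta> \<kappa>bv V"
  shows "\<P>(\<omega> in M. (\<lambda>k. norm (transpose (jacobian F (at (X k \<omega>))) *v F (X k \<omega>)))
           \<longlonglongrightarrow> 0) = 1"
proof -
  interpret prob_space M by (rule prob)
  let ?T = "\<lambda>k. bounded_RIP_event M s \<kappa>bv (V k)"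
  let ?y = "\<lambda>k \<omega>. norm (objective_grad F (X k \<omega>))"
  interpret L: likely_events M "past M V" ?T \<beta>
    by (rule likely_events_bounded_RIP[OF prob \<open>s \<ge> 1\<close> V_random RIP])
  have run: "lm_run F \<eta>0 \<eta>1 \<eta>2 \<gamma>1 \<gamma>2 \<theta>min \<theta>0 \<kappa>lg \<kappa>bv s x0 (\<lambda>k. \<Sigma> k \<omega>) (\<lambda>k. \<Xi> k \<omega>)
      (\<lambda>k. V k \<omega>) (\<lambda>k. X k \<omega>) (\<lambda>k. \<Theta> k \<omega>) (\<lambda>k. Jm k \<omega>) (\<lambda>k. D k \<omega>)" if "\<omega> \<in> space M" for \<omega>
    by (rule lm_run.intro[OF \<open>s \<ge> 1\<close> \<open>0 < \<eta>0\<close> \<open>\<eta>0 < 1\<close> \<open>0 < \<eta>1\<close> \<open>\<eta>1 < \<eta>2\<close> \<open>0 < \<gamma>1\<close> \<open>\<gamma>1 < 1\<close>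
          \<open>1 < \<gamma>2\<close> \<open>0 < \<theta>min\<close> \<open>\<theta>min \<le> \<theta>0\<close> A1_C1 A1_lipschitz A1_sparse A2_compact A2_lipschitz
          algorithm[OF that] sigma(2)[OF that] xi[OF that] A3[OF that]])
  have y_meas: "?y k \<in> borel_measurable (past M V k)" for k
    by (intro measurable_compose[OF X_adapted] borel_measurable_continuous_onI
        continuous_on_norm continuous_objective_grad[OF A1_C1])

  have walk: "AE \<omega> in M. \<forall>c. \<exists>n. c < (\<Sum>k<n. if \<omega> \<in> ?T k then - ln \<gamma>1 else - ln \<gamma>2)"
  proof (rule L.walk_unbounded)
    show "0 < - ln \<gamma>1" "0 < ln \<gamma>2" using \<open>0 < \<gamma>1\<close> \<open>\<gamma>1 < 1\<close> \<open>1 < \<gamma>2\<close> by auto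
    then show "(1 - \<beta>) * ln \<gamma>2 \<le> \<beta> * - ln \<gamma>1"
      using beta(3) by (simp add: pos_divide_le_eq algebra_simps)
  qed (use beta in auto)

  \<comment> \<open>The truncated value \<open>min (1 / \<bar>\<Theta> k \<omega>\<bar>) (1 / \<theta>min)\<close> is nonnegative and bounded for every \<open>\<omega>\<close>,
    and equals \<open>1 / \<Theta> k \<omega>\<close> on every realization.\<close>
  have "AE \<omega> in M. \<forall>N. summable (\<lambda>k. (if 1 / real (Suc N) \<le> ?y k \<omega> then min (1 / \<bar>\<Theta> k \<omega>\<bar>) (1 / \<theta>min) else 0)
        * indicator (?T k) \<omega>) \<longrightarrow>
      summable (\<lambda>k. if 1 / real (Suc N) \<le> ?y k \<omega> then min (1 / \<bar>\<Theta> k \<omega>\<bar>) (1 / \<theta>min) else 0)"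
    unfolding AE_all_countable
  proof (intro allI L.summable_of_summable_on_T[where B = "1 / \<theta>min"])
    fix N k
    show "(\<lambda>\<omega>. if 1 / real (Suc N) \<le> ?y k \<omega> then min (1 / \<bar>\<Theta> k \<omega>\<bar>) (1 / \<theta>min) else 0)
        \<in> borel_measurable (past M V k)"
      using y_meas[of k] \<Theta>_adapted[of k] by measurable
  qed (use \<open>0 < \<theta>min\<close> beta in auto)
  with walk have AE: "AE \<omega> in M. (\<lambda>k. ?y k \<omega>) \<longlonglongrightarrow> 0"
  proof (rule AE_mp[OF _ AE_mp], intro AE_I2 impI)
    fix \<omega> assume \<omega>: "\<omega> \<in> space M"
      and transfer: "\<forall>N. summable (\<lambda>k. (if 1 / real (Suc N) \<le> ?y k \<omega> then min (1 / \<bar>\<Theta> k \<omega>\<bar>) (1 / \<theta>min) else 0)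
        * indicator (?T k) \<omega>) \<longrightarrow>
      summable (\<lambda>k. if 1 / real (Suc N) \<le> ?y k \<omega> then min (1 / \<bar>\<Theta> k \<omega>\<bar>) (1 / \<theta>min) else 0)"
      and walk: "\<forall>c. \<exists>n. c < (\<Sum>k<n. if \<omega> \<in> ?T k then - ln \<gamma>1 else - ln \<gamma>2)"
    interpret R: lm_run F \<eta>0 \<eta>1 \<eta>2 \<gamma>1 \<gamma>2 \<theta>min \<theta>0 \<kappa>lg \<kappa>bv s x0 "\<lambda>k. \<Sigma> k \<omega>" "\<lambda>k. \<Xi> k \<omega>"
      "\<lambda>k. V k \<omega>" "\<lambda>k. X k \<omega>" "\<lambda>k. \<Theta> k \<omega>" "\<lambda>k. Jm k \<omega>" "\<lambda>k. D k \<omega>" by (rule run[OF \<omega>])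
    have T: "\<omega> \<in> ?T k \<longleftrightarrow> R.good k" for k using \<omega> by (simp add: bounded_RIP_event_def R.good_def)
    have m: "min (1 / \<bar>\<Theta> k \<omega>\<bar>) (1 / \<theta>min) = 1 / \<Theta> k \<omega>" for k
      using R.\<theta>_pos[of k] R.\<theta>_ge_min[of k] \<open>0 < \<theta>min\<close> by (simp add: min_def field_simps)
    have "R.grad_norm \<longlonglongrightarrow> 0"
    proof (rule R.gradient_tendsto_zero)
      show "\<exists>n. c < R.walk n" for c using walk by (simp add: R.walk_def T)
      fix N
      assume "summable (\<lambda>k. if R.good k \<and> 1 / real (Suc N) \<le> R.grad_norm k then 1 / \<Theta> k \<omega> else 0)"
      also have "(\<lambda>k. if R.good k \<and> 1 / real (Suc N) \<le> R.grad_norm k then 1 / \<Theta> k \<omega> else 0)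
          = (\<lambda>k. (if 1 / real (Suc N) \<le> ?y k \<omega> then min (1 / \<bar>\<Theta> k \<omega>\<bar>) (1 / \<theta>min) else 0)
              * indicator (?T k) \<omega>)"
        by (auto simp: m T R.grad_norm_def indicator_def)
      finally show "summable (\<lambda>k. if 1 / real (Suc N) \<le> R.grad_norm k then 1 / \<Theta> k \<omega> else 0)"
        using transfer unfolding m R.grad_norm_def by blast
    qed
    then show "(\<lambda>k. ?y k \<omega>) \<longlonglongrightarrow> 0" unfolding R.grad_norm_def .
  qed
  have "{\<omega> \<in> space M. (\<lambda>k. ?y k \<omega>) \<longlonglongrightarrow> 0} \<in> sets M"
  proof -
    have [measurable]: "?y k \<in> borel_measurable M" for k by (rule L.measurable_M[OF y_meas])
    show ?thesis by measurable
  qed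
  then show ?thesis
    using AE unfolding objective_grad_def by (subst prob_Collect_eq_1) auto
qed

end
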